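(* Let $M$ be a smooth paracompact manifold of dimension $n\ge 3$, and $\Gamma$ a spray on $T^\circ M$ for whose projective class the path space $\pi:T^\circ M\to P_{\mathcal{D}}$ exists as a smooth manifold. Let $\omega=h_{ij}\,dx^i\wedge\phi^j$ be an admissible 2-form on $T^\circ M$ whose characteristic distribution is exactly $\mathcal{D}$, and $\Omega$ the symplectic form on $P_{\mathcal{D}}$ with $\pi^*\Omega=\omega$. Let $\Gamma$ be such that for every $x\in M$ and every two-dimensional subspace of $T_xM$ there is a totally-geodesic submanifold through $x$ with the given subspace as its tangent space. If $h$ is everywhere positive quasi-definite, the pull-back of $\Omega$ to any submanifold $\bar N=\pi(\hat N)$ of $P_{\mathcal{D}}$, with $N$ a two-dimensional totally-geodesic submanifold of $M$, is non-vanishing (i.e. it is a volume form). Conversely, if $\Omega$ has this property then either $h$ or $-h$ is everywhere positive quasi-definite.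
   Context: $\tau:T^\circ M\to M$ is the tangent bundle with the zero section removed, with coordinates $(x^i,y^i)$; $\Delta=y^i\partial/\partial y^i$. A spray is a vector field $\Gamma=y^i\frac{\partial}{\partial x^i}-2\Gamma^i\frac{\partial}{\partial y^i}$ on $T^\circ M$ with $[\Delta,\Gamma]=\Gamma$; its projective class consists of all $\Gamma-2P\Delta$ with $\Delta(P)=P$; $\mathcal{D}$ is the involutive distribution spanned by $\Delta$ and $\Gamma$. Put $V_i=\partial/\partial y^i$, $H_i=\partial/\partial x^i-\Gamma^j_iV_j$, $\Gamma^j_i=\partial\Gamma^j/\partial y^i$, $\phi^i=dy^i+\Gamma^i_jdx^j$. Path space: a $(2n-2)$-dimensional manifold $P_{\mathcal{D}}$ with a fibration $\pi:T^\circ M\to P_{\mathcal{D}}$ whose fibres are the leaves of $\mathcal{D}$. A 2-form $\omega$ on $T^\circ M$ is called admissible here if: (1) its characteristic distribution $\{Z:i_Z\omega=0\}$ contains $\mathcal{D}$; (2) $\mathcal{L}_\Gamma\omega=0$; (3) $\omega(V_1,V_2)=0$ for all vertical vector fields $V_1,V_2$; (4) $d\omega(H,V_1,V_2)=0$ for every horizontal $H$ (in the span of the $H_i$) and vertical $V_1,V_2$. Such $\omega$ is closed and of the form $h_{ij}dx^i\wedge\phi^j$ with $h_{ij}$ symmetric and $h_{ij}y^j=0$; when its characteristic distribution is $\mathcal{D}$ it is $\pi^*\Omega$ for a unique symplectic form $\Omega$ on $P_{\mathcal{D}}$. $h$ is positive quasi-definite if $h_{ij}(y)v^iv^j\ge0$,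 with equality only if $v$ is a scalar multiple of $y$. For a proper embedded submanifold $N$ of $M$, $\hat N=\{(x,y)\in T^\circ M: x\in N,\ y\in T_xN\}$. $N$ is totally geodesic if $\Gamma$ is tangent to $\hat N$. For two-dimensional totally-geodesic $N$, $\bar N=\pi(\hat N)$ is the two-dimensional submanifold of $P_{\mathcal{D}}$ whose points are the geodesic paths in $N$, with tangent spaces $\pi_*(T_{(x,y)}\hat N)$.
   Formalization: In the converse M is also assumed connected; otherwise it fails: on two disjoint copies of R^3 with the flat spray, take opposite signs of h on the two components, so that neither h nor -h is everywhere positive quasi-definite. *)

theory Defs
  imports "HOL-Analysis.Analysis"
begin

section \<open>Smooth maps between open subsets of normed spaces\<close>

primrec k_smooth_on ::
  "nat \<Rightarrow> 'a::real_normed_vector set \<Rightarrow> ('a \<Rightarrow> 'b::real_normed_vector) \<Rightarrow> bool" where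
  "k_smooth_on 0 S f \<longleftrightarrow> continuous_on S f"
| "k_smooth_on (Suc k) S f \<longleftrightarrow>
     (\<forall>x\<in>S. f differentiable (at x)) \<and>
     (\<forall>v. k_smooth_on k S (\<lambda>x. frechet_derivative f (at x) v))"

text \<open>Only used for open S.\<close>

definition smooth_on ::
  "'a::real_normed_vector set \<Rightarrow> ('a \<Rightarrow> 'b::real_normed_vector) \<Rightarrow> bool" where
  "smooth_on S f \<longleftrightarrow> (\<forall>k. k_smooth_on k S f)"


section \<open>Smooth manifolds\<close>

text \<open>A chart is a domain together with a coordinate map; the values of the coordinate map
  outside the domain are irrelevant.\<close>

type_synonym ('a, 'e) chart = "'a set \<times> ('a \<Rightarrow> 'e)"

abbreviation cdom :: "('a, 'e) chart \<Rightarrow> 'a set" where "cdom \<equiv> fst"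
abbreviation cmap :: "('a, 'e) chart \<Rightarrow> 'a \<Rightarrow> 'e" where "cmap \<equiv> snd"

definition cimg :: "('a, 'e) chart \<Rightarrow> 'e set" where
  "cimg c = cmap c ` cdom c"

definition cinv :: "('a, 'e) chart \<Rightarrow> 'e \<Rightarrow> 'a" where
  "cinv c = inv_into (cdom c) (cmap c)"

record ('a, 'e) mfd =
  mtop :: "'a topology"
  atlas :: "('a, 'e) chart set"

abbreviation points :: "('a, 'e) mfd \<Rightarrow> 'a set" where
  "points M \<equiv> topspace (mtop M)"

definition top_chart :: "'a topology \<Rightarrow> ('a, 'e::euclidean_space) chart \<Rightarrow> bool" where
  "top_chart X c \<longleftrightarrow> openin X (cdom c) \<and> open (cimg c) \<and>
     homeomorphic_map (subtopology X (cdom c)) (top_of_set (cimg c)) (cmap c)"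

definition transition :: "('a, 'e) chart \<Rightarrow> ('a, 'e) chart \<Rightarrow> 'e \<Rightarrow> 'e" where
  "transition c d = cmap d \<circ> cinv c"

definition compatible ::
  "('a, 'e::euclidean_space) chart \<Rightarrow> ('a, 'e) chart \<Rightarrow> bool" where
  "compatible c d \<longleftrightarrow>
     smooth_on (cmap c ` (cdom c \<inter> cdom d)) (transition c d) \<and>
     smooth_on (cmap d ` (cdom c \<inter> cdom d)) (transition d c)"

definition smooth_manifold :: "('a, 'e::euclidean_space) mfd \<Rightarrow> bool" where
  "smooth_manifold M \<longleftrightarrow>
     Hausdorff_space (mtop M) \<and>
     (\<forall>c\<in>atlas M. top_chart (mtop M) c) \<and>
     (\<Union>c\<in>atlas M. cdom c) = points M \<and>
     (\<forall>c\<in>atlas M. \<forall>d\<in>atlas M. compatible c d) \<and>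
     (\<forall>c. top_chart (mtop M) c \<and> (\<forall>d\<in>atlas M. compatible c d) \<longrightarrow> c \<in> atlas M)"

definition paracompact_space :: "'a topology \<Rightarrow> bool" where
  "paracompact_space X \<longleftrightarrow>
     (\<forall>\<U>. (\<forall>U\<in>\<U>. openin X U) \<and> \<Union>\<U> = topspace X \<longrightarrow>
       (\<exists>\<V>. (\<forall>V\<in>\<V>. openin X V) \<and> \<Union>\<V> = topspace X \<and>
             (\<forall>V\<in>\<V>. \<exists>U\<in>\<U>. V \<subseteq> U) \<and> locally_finite_in X \<V>))"

definition smooth_map ::
  "('a, 'e::euclidean_space) mfd \<Rightarrow> ('b, 'f::euclidean_space) mfd \<Rightarrow> ('a \<Rightarrow> 'b) \<Rightarrow> bool" where
  "smooth_map M N f \<longleftrightarrow> continuous_map (mtop M) (mtop N) f \<and>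
     (\<forall>c\<in>atlas M. \<forall>d\<in>atlas N.
        smooth_on (cmap c ` {p \<in> cdom c. f p \<in> cdom d}) (cmap d \<circ> f \<circ> cinv c))"


section \<open>Tangent vectors\<close>

text \<open>A tangent vector at p is the family of its coordinate vectors in all the charts around p,
  related by the derivatives of the transition maps; it is extended by 0 to all other
  arguments.\<close>

type_synonym ('a, 'e) tvec = "('a, 'e) chart \<Rightarrow> 'e"

definition tangent_space :: "('a, 'e::euclidean_space) mfd \<Rightarrow> 'a \<Rightarrow> ('a, 'e) tvec set" where
  "tangent_space M p = {v.
     (\<forall>c\<in>atlas M. \<forall>d\<in>atlas M. p \<in> cdom c \<and> p \<in> cdom d \<longrightarrow>
        v d = frechet_derivative (transition c d) (at (cmap c p)) (v c)) \<and>
     (\<forall>c. \<not> (c \<in> atlas M \<and> p \<in> cdom c) \<longrightarrow> v c = 0)}"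

text \<open>The tangent vector at p whose coordinate vector in the chart c is a.\<close>

definition tvec_of :: "('a, 'e::euclidean_space) mfd \<Rightarrow> ('a, 'e) chart \<Rightarrow> 'a \<Rightarrow> 'e \<Rightarrow> ('a, 'e) tvec" where
  "tvec_of M c p a = (\<lambda>d. if d \<in> atlas M \<and> p \<in> cdom d
     then frechet_derivative (transition c d) (at (cmap c p)) a else 0)"

definition tangent_subspace ::
  "('a, 'e::euclidean_space) mfd \<Rightarrow> 'a \<Rightarrow> nat \<Rightarrow> ('a, 'e) tvec set \<Rightarrow> bool" where
  "tangent_subspace M p k W \<longleftrightarrow> W \<subseteq> tangent_space M p \<and>
     (\<forall>c\<in>atlas M. p \<in> cdom c \<longrightarrow>
        subspace ((\<lambda>v. v c) ` W) \<and> dim ((\<lambda>v. v c) ` W) = k)"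

text \<open>The differential of a smooth map f at p; the result does not depend on the chart c.\<close>

definition push ::
  "('a, 'e::euclidean_space) mfd \<Rightarrow> ('b, 'f::euclidean_space) mfd \<Rightarrow> ('a \<Rightarrow> 'b) \<Rightarrow> 'a
     \<Rightarrow> ('a, 'e) tvec \<Rightarrow> ('b, 'f) tvec" where
  "push M N f p v = (\<lambda>d. if d \<in> atlas N \<and> f p \<in> cdom d
     then (let c = (SOME c. c \<in> atlas M \<and> p \<in> cdom c)
           in frechet_derivative (cmap d \<circ> f \<circ> cinv c) (at (cmap c p)) (v c))
     else 0)"

definition smooth_curve ::
  "('a, 'e::euclidean_space) mfd \<Rightarrow> real set \<Rightarrow> (real \<Rightarrow> 'a) \<Rightarrow> bool" where
  "smooth_curve M I \<gamma> \<longleftrightarrow> continuous_map (top_of_set I) (mtop M) \<gamma> \<and>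
     (\<forall>c\<in>atlas M. smooth_on {t\<in>I. \<gamma> t \<in> cdom c} (cmap c \<circ> \<gamma>))"

definition velocity ::
  "('a, 'e::euclidean_space) mfd \<Rightarrow> (real \<Rightarrow> 'a) \<Rightarrow> real \<Rightarrow> ('a, 'e) tvec" where
  "velocity M \<gamma> t = (\<lambda>c. if c \<in> atlas M \<and> \<gamma> t \<in> cdom c
     then vector_derivative (cmap c \<circ> \<gamma>) (at t) else 0)"

text \<open>For an embedded submanifold S this is its tangent space at p, as a subspace of the
  tangent space of M.\<close>

definition tangent_to ::
  "('a, 'e::euclidean_space) mfd \<Rightarrow> 'a set \<Rightarrow> 'a \<Rightarrow> ('a, 'e) tvec set" where
  "tangent_to M S p = {velocity M \<gamma> 0 | \<gamma>. \<exists>\<epsilon>>0.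
     \<gamma> 0 = p \<and> \<gamma> ` {-\<epsilon><..<\<epsilon>} \<subseteq> S \<and> smooth_curve M {-\<epsilon><..<\<epsilon>} \<gamma>}"

text \<open>Slice charts are taken from the atlas of M itself, which is meant to be maximal.\<close>

definition embedded_submanifold ::
  "('a, 'e::euclidean_space) mfd \<Rightarrow> nat \<Rightarrow> 'a set \<Rightarrow> bool" where
  "embedded_submanifold M k N \<longleftrightarrow> N \<subseteq> points M \<and>
     (\<forall>p\<in>N. \<exists>c\<in>atlas M. p \<in> cdom c \<and>
        (\<exists>W. subspace W \<and> dim W = k \<and> cmap c ` (cdom c \<inter> N) = cimg c \<inter> W))"

definition proper_embedded_submanifold ::
  "('a, 'e::euclidean_space) mfd \<Rightarrow> nat \<Rightarrow> 'a set \<Rightarrow> bool" where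
  "proper_embedded_submanifold M k N \<longleftrightarrow> embedded_submanifold M k N \<and>
     proper_map (subtopology (mtop M) N) (mtop M) id"


section \<open>Vector fields and 2-forms\<close>

type_synonym ('a, 'e) vfield = "'a \<Rightarrow> ('a, 'e) tvec"

definition field_rep :: "('a, 'e) vfield \<Rightarrow> ('a, 'e) chart \<Rightarrow> 'e \<Rightarrow> 'e" where
  "field_rep X c u = X (cinv c u) c"

definition vector_field :: "('a, 'e::euclidean_space) mfd \<Rightarrow> ('a, 'e) vfield \<Rightarrow> bool" where
  "vector_field M X \<longleftrightarrow> (\<forall>p\<in>points M. X p \<in> tangent_space M p) \<and>
     (\<forall>c\<in>atlas M. smooth_on (cimg c) (field_rep X c))"

definition bracket_rep ::
  "('e::real_normed_vector \<Rightarrow> 'e) \<Rightarrow> ('e \<Rightarrow> 'e) \<Rightarrow> 'e \<Rightarrow> 'e" where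
  "bracket_rep X Y u =
     frechet_derivative Y (at u) (X u) - frechet_derivative X (at u) (Y u)"

type_synonym ('a, 'e) form2 = "'a \<Rightarrow> ('a, 'e) tvec \<Rightarrow> ('a, 'e) tvec \<Rightarrow> real"

definition form_rep ::
  "('a, 'e::euclidean_space) mfd \<Rightarrow> ('a, 'e) form2 \<Rightarrow> ('a, 'e) chart \<Rightarrow> 'e \<Rightarrow> 'e \<Rightarrow> 'e \<Rightarrow> real" where
  "form_rep M \<alpha> c u a b =
     \<alpha> (cinv c u) (tvec_of M c (cinv c u) a) (tvec_of M c (cinv c u) b)"

definition two_form :: "('a, 'e::euclidean_space) mfd \<Rightarrow> ('a, 'e) form2 \<Rightarrow> bool" where
  "two_form M \<alpha> \<longleftrightarrow> (\<forall>c\<in>atlas M.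
     (\<forall>u\<in>cimg c. bilinear (form_rep M \<alpha> c u) \<and> (\<forall>a. form_rep M \<alpha> c u a a = 0)) \<and>
     (\<forall>a b. smooth_on (cimg c) (\<lambda>u. form_rep M \<alpha> c u a b)))"

definition ext_deriv_rep ::
  "('e::real_normed_vector \<Rightarrow> 'e \<Rightarrow> 'e \<Rightarrow> real) \<Rightarrow> 'e \<Rightarrow> 'e \<Rightarrow> 'e \<Rightarrow> 'e \<Rightarrow> real" where
  "ext_deriv_rep \<beta> u a b c =
     frechet_derivative (\<lambda>u. \<beta> u b c) (at u) a
   + frechet_derivative (\<lambda>u. \<beta> u c a) (at u) b
   + frechet_derivative (\<lambda>u. \<beta> u a b) (at u) c"

definition lie_deriv_rep ::
  "('e::real_normed_vector \<Rightarrow> 'e) \<Rightarrow> ('e \<Rightarrow> 'e \<Rightarrow> 'e \<Rightarrow> real) \<Rightarrow> 'e \<Rightarrow> 'e \<Rightarrow> 'e \<Rightarrow> real" where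
  "lie_deriv_rep X \<beta> u a b =
     frechet_derivative (\<lambda>u. \<beta> u a b) (at u) (X u)
   + \<beta> u (frechet_derivative X (at u) a) b
   + \<beta> u a (frechet_derivative X (at u) b)"

definition characteristic ::
  "('a, 'e::euclidean_space) mfd \<Rightarrow> ('a, 'e) form2 \<Rightarrow> 'a \<Rightarrow> ('a, 'e) tvec set" where
  "characteristic M \<alpha> p =
     {\<xi>\<in>tangent_space M p. \<forall>\<eta>\<in>tangent_space M p. \<alpha> p \<xi> \<eta> = 0}"

definition closed_form :: "('a, 'e::euclidean_space) mfd \<Rightarrow> ('a, 'e) form2 \<Rightarrow> bool" where
  "closed_form M \<alpha> \<longleftrightarrow>
     (\<forall>c\<in>atlas M. \<forall>u\<in>cimg c. \<forall>a b e. ext_deriv_rep (form_rep M \<alpha> c) u a b e = 0)"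

definition symplectic_form :: "('a, 'e::euclidean_space) mfd \<Rightarrow> ('a, 'e) form2 \<Rightarrow> bool" where
  "symplectic_form M \<Omega> \<longleftrightarrow> two_form M \<Omega> \<and> closed_form M \<Omega> \<and>
     (\<forall>p\<in>points M. characteristic M \<Omega> p = {\<lambda>_. 0})"

definition pullback ::
  "('a, 'e::euclidean_space) mfd \<Rightarrow> ('b, 'f::euclidean_space) mfd \<Rightarrow> ('a \<Rightarrow> 'b)
     \<Rightarrow> ('b, 'f) form2 \<Rightarrow> ('a, 'e) form2" where
  "pullback M N f \<alpha> p \<xi> \<eta> = \<alpha> (f p) (push M N f p \<xi>) (push M N f p \<eta>)"


section \<open>Rank-two distributions and their leaves\<close>

text \<open>Integral manifolds are immersed: they carry their own topology and smooth structure.\<close>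

definition integral_manifold ::
  "('a, 'e::euclidean_space) mfd \<Rightarrow> ('a \<Rightarrow> ('a, 'e) tvec set) \<Rightarrow> ('a, real^2) mfd \<Rightarrow> bool" where
  "integral_manifold M D L \<longleftrightarrow> smooth_manifold L \<and> points L \<subseteq> points M \<and> smooth_map L M id \<and>
     (\<forall>p\<in>points L. inj_on (push L M id p) (tangent_space L p) \<and>
                   push L M id p ` tangent_space L p = D p)"

definition leaf ::
  "('a, 'e::euclidean_space) mfd \<Rightarrow> ('a \<Rightarrow> ('a, 'e) tvec set) \<Rightarrow> 'a set \<Rightarrow> bool" where
  "leaf M D S \<longleftrightarrow> S \<noteq> {} \<and>
     (\<exists>L. integral_manifold M D L \<and> connected_space (mtop L) \<and> points L = S) \<and>
     (\<forall>L'. integral_manifold M D L' \<and> connected_space (mtop L') \<and> S \<subseteq> points L'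
            \<longrightarrow> points L' = S)"


section \<open>The slit tangent bundle\<close>

definition slit_points ::
  "('m, 'e::euclidean_space) mfd \<Rightarrow> ('m \<times> ('m, 'e) tvec) set" where
  "slit_points M = {(x, y). x \<in> points M \<and> y \<in> tangent_space M x \<and> y \<noteq> (\<lambda>_. 0)}"

text \<open>The chart \<open>(x\<^sup>i, y\<^sup>i)\<close> induced by the chart \<open>(x\<^sup>i)\<close>.\<close>

definition lift_chart ::
  "('m, 'e::euclidean_space) mfd \<Rightarrow> ('m, 'e) chart \<Rightarrow> ('m \<times> ('m, 'e) tvec, 'e \<times> 'e) chart" where
  "lift_chart M c = ({(x, y)\<in>slit_points M. x \<in> cdom c}, \<lambda>(x, y). (cmap c x, y c))"

definition slit_bundle ::
  "('m, 'e::euclidean_space) mfd \<Rightarrow> ('m \<times> ('m, 'e) tvec, 'e \<times> 'e) mfd" where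
  "slit_bundle M =
     \<lparr> mtop = topology_generated_by
         {{z\<in>cdom (lift_chart M c). cmap (lift_chart M c) z \<in> T} | c T. c \<in> atlas M \<and> open T},
       atlas = lift_chart M ` atlas M \<rparr>"

type_synonym ('m, 'e) tm = "'m \<times> ('m, 'e) tvec"

definition liouville ::
  "('m, 'e::euclidean_space) mfd \<Rightarrow> (('m, 'e) tm, 'e \<times> 'e) vfield" where
  "liouville M z = (\<lambda>C. if C \<in> atlas (slit_bundle M) \<and> z \<in> cdom C then (0, snd (cmap C z)) else 0)"

definition spray ::
  "('m, 'e::euclidean_space) mfd \<Rightarrow> (('m, 'e) tm, 'e \<times> 'e) vfield \<Rightarrow> bool" where
  "spray M \<Gamma> \<longleftrightarrow> vector_field (slit_bundle M) \<Gamma> \<and>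
     (\<forall>C\<in>atlas (slit_bundle M). \<forall>u\<in>cimg C.
        fst (field_rep \<Gamma> C u) = snd u \<and>
        bracket_rep (field_rep (liouville M) C) (field_rep \<Gamma> C) u = field_rep \<Gamma> C u)"

text \<open>The coefficients \<open>\<Gamma>\<^sup>i\<close>, from \<open>\<Gamma> = y\<^sup>i \<partial>/\<partial>x\<^sup>i - 2 \<Gamma>\<^sup>i \<partial>/\<partial>y\<^sup>i\<close>, and the linear map
  \<open>w \<mapsto> \<Gamma>\<^sup>j\<^sub>i w\<^sup>i\<close>, where \<open>\<Gamma>\<^sup>j\<^sub>i = \<partial>\<Gamma>\<^sup>j/\<partial>y\<^sup>i\<close>, in a chart C of the slit tangent bundle.\<close>

definition spray_coeff ::
  "(('m, 'e::euclidean_space) tm, 'e \<times> 'e) vfield \<Rightarrow> (('m, 'e) tm, 'e \<times> 'e) chart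
     \<Rightarrow> 'e \<times> 'e \<Rightarrow> 'e" where
  "spray_coeff \<Gamma> C u = - (1/2) *\<^sub>R snd (field_rep \<Gamma> C u)"

definition conn_coeff ::
  "(('m, 'e::euclidean_space) tm, 'e \<times> 'e) vfield \<Rightarrow> (('m, 'e) tm, 'e \<times> 'e) chart
     \<Rightarrow> 'e \<times> 'e \<Rightarrow> 'e \<Rightarrow> 'e" where
  "conn_coeff \<Gamma> C u w =
     frechet_derivative (\<lambda>y. spray_coeff \<Gamma> C (fst u, y)) (at (snd u)) w"

text \<open>Coordinate expressions of \<open>w\<^sup>i H\<^sub>i\<close>, of \<open>w\<^sup>i V\<^sub>i\<close> and of the 1-forms \<open>\<phi>\<^sup>i\<close> (as one
  vector-valued 1-form).\<close>

definition horizontal where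
  "horizontal \<Gamma> C u w = (w, - conn_coeff \<Gamma> C u w)"

definition vertical :: "'e::euclidean_space \<Rightarrow> 'e \<times> 'e" where
  "vertical w = (0, w)"

definition phi where
  "phi \<Gamma> C u a = snd a + conn_coeff \<Gamma> C u (fst a)"

definition spray_distribution ::
  "('m, 'e::euclidean_space) mfd \<Rightarrow> (('m, 'e) tm, 'e \<times> 'e) vfield
     \<Rightarrow> ('m, 'e) tm \<Rightarrow> (('m, 'e) tm, 'e \<times> 'e) tvec set" where
  "spray_distribution M \<Gamma> z =
     {(\<lambda>C. a *\<^sub>R liouville M z C + b *\<^sub>R \<Gamma> z C) | a b. True}"

text \<open>The path space: the fibration is a surjective submersion whose fibres are the leaves of the
  distribution spanned by the Liouville field and the spray. That distribution, hence the path
  space, depends on the projective class of the spray only.\<close>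

definition path_space ::
  "('m, 'e::euclidean_space) mfd \<Rightarrow> (('m, 'e) tm, 'e \<times> 'e) vfield
     \<Rightarrow> ('p, 'q::euclidean_space) mfd \<Rightarrow> (('m, 'e) tm \<Rightarrow> 'p) \<Rightarrow> bool" where
  "path_space M \<Gamma> P \<pi> \<longleftrightarrow>
     smooth_manifold P \<and> DIM('q) = 2 * DIM('e) - 2 \<and>
     smooth_map (slit_bundle M) P \<pi> \<and> \<pi> ` slit_points M = points P \<and>
     (\<forall>z\<in>slit_points M. push (slit_bundle M) P \<pi> z ` tangent_space (slit_bundle M) z
                         = tangent_space P (\<pi> z)) \<and>
     (\<lambda>q. {z\<in>slit_points M. \<pi> z = q}) ` points P
       = {S. leaf (slit_bundle M) (spray_distribution M \<Gamma>) S}"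

definition admissible ::
  "('m, 'e::euclidean_space) mfd \<Rightarrow> (('m, 'e) tm, 'e \<times> 'e) vfield
     \<Rightarrow> (('m, 'e) tm, 'e \<times> 'e) form2 \<Rightarrow> bool" where
  "admissible M \<Gamma> \<omega> \<longleftrightarrow> two_form (slit_bundle M) \<omega> \<and>
     (\<forall>z\<in>slit_points M. spray_distribution M \<Gamma> z \<subseteq> characteristic (slit_bundle M) \<omega> z) \<and>
     (\<forall>C\<in>atlas (slit_bundle M). \<forall>u\<in>cimg C.
        (\<forall>a b. lie_deriv_rep (field_rep \<Gamma> C) (form_rep (slit_bundle M) \<omega> C) u a b = 0) \<and>
        (\<forall>v w. form_rep (slit_bundle M) \<omega> C u (vertical v) (vertical w) = 0) \<and>
        (\<forall>a v w. ext_deriv_rep (form_rep (slit_bundle M) \<omega> C) u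
                   (horizontal \<Gamma> C u a) (vertical v) (vertical w) = 0))"

text \<open>Components \<open>h\<^sub>i\<^sub>j\<close>, given for each chart of M as a function of the coordinates (x, y);
  \<open>has_components\<close> says that \<open>\<omega> = h\<^sub>i\<^sub>j dx\<^sup>i \<and> \<phi>\<^sup>j\<close>, where
  \<open>(\<alpha> \<and> \<beta>)(a, b) = \<alpha>(a) \<beta>(b) - \<alpha>(b) \<beta>(a)\<close>.\<close>

type_synonym ('m, 'n) components =
  "('m, real^'n) chart \<Rightarrow> (real^'n) \<times> (real^'n) \<Rightarrow> real^'n^'n"

definition has_components ::
  "('m, real^'n) mfd \<Rightarrow> (('m, real^'n) tm, (real^'n) \<times> (real^'n)) vfield
     \<Rightarrow> (('m, real^'n) tm, (real^'n) \<times> (real^'n)) form2 \<Rightarrow> ('m, 'n::finite) components \<Rightarrow> bool" where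
  "has_components M \<Gamma> \<omega> h \<longleftrightarrow>
     (\<forall>c\<in>atlas M. \<forall>u\<in>cimg (lift_chart M c). \<forall>a b.
        form_rep (slit_bundle M) \<omega> (lift_chart M c) u a b =
          (\<Sum>i\<in>UNIV. \<Sum>j\<in>UNIV. h c u $ i $ j *
             (fst a $ i * phi \<Gamma> (lift_chart M c) u b $ j
              - fst b $ i * phi \<Gamma> (lift_chart M c) u a $ j)))"

definition positive_quasi_definite ::
  "('m, real^'n) mfd \<Rightarrow> ('m, 'n::finite) components \<Rightarrow> bool" where
  "positive_quasi_definite M h \<longleftrightarrow>
     (\<forall>c\<in>atlas M. \<forall>(x, y)\<in>cimg (lift_chart M c). \<forall>v.
        (\<Sum>i\<in>UNIV. \<Sum>j\<in>UNIV. h c (x, y) $ i $ j * v $ i * v $ j) \<ge> 0 \<and>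
        ((\<Sum>i\<in>UNIV. \<Sum>j\<in>UNIV. h c (x, y) $ i $ j * v $ i * v $ j) = 0 \<longrightarrow> (\<exists>s. v = s *\<^sub>R y)))"


section \<open>Totally geodesic submanifolds\<close>

definition hat :: "('m, 'e::euclidean_space) mfd \<Rightarrow> 'm set \<Rightarrow> ('m, 'e) tm set" where
  "hat M N = {(x, y)\<in>slit_points M. x \<in> N \<and> y \<in> tangent_to M N x}"

definition totally_geodesic ::
  "('m, 'e::euclidean_space) mfd \<Rightarrow> (('m, 'e) tm, 'e \<times> 'e) vfield \<Rightarrow> nat \<Rightarrow> 'm set \<Rightarrow> bool" where
  "totally_geodesic M \<Gamma> k N \<longleftrightarrow> proper_embedded_submanifold M k N \<and>
     (\<forall>z\<in>hat M N. \<Gamma> z \<in> tangent_to (slit_bundle M) (hat M N) z)"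

text \<open>The tangent space, at the point \<open>\<pi> z\<close>, of the submanifold \<open>\<pi> ` hat M N\<close> of the path
  space. The latter submanifold is two-dimensional if N is, so a 2-form pulls back to a volume
  form on it iff it does not vanish identically on any of these spaces.\<close>

definition bar_tangent ::
  "('m, 'e::euclidean_space) mfd \<Rightarrow> ('p, 'q::euclidean_space) mfd \<Rightarrow> (('m, 'e) tm \<Rightarrow> 'p)
     \<Rightarrow> 'm set \<Rightarrow> ('m, 'e) tm \<Rightarrow> ('p, 'q) tvec set" where
  "bar_tangent M P \<pi> N z =
     push (slit_bundle M) P \<pi> z ` tangent_to (slit_bundle M) (hat M N) z"

definition nonvanishing_on_bar ::
  "('m, 'e::euclidean_space) mfd \<Rightarrow> ('p, 'q::euclidean_space) mfd \<Rightarrow> (('m, 'e) tm \<Rightarrow> 'p)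
     \<Rightarrow> ('p, 'q) form2 \<Rightarrow> 'm set \<Rightarrow> bool" where
  "nonvanishing_on_bar M P \<pi> \<Omega> N \<longleftrightarrow>
     (\<forall>z\<in>hat M N. \<exists>\<xi>\<in>bar_tangent M P \<pi> N z. \<exists>\<eta>\<in>bar_tangent M P \<pi> N z. \<Omega> (\<pi> z) \<xi> \<eta> \<noteq> 0)"

end

theory Submission
  imports Defs
begin

text \<open>Let \<open>N\<close> be a totally geodesic surface and \<open>(x, y)\<close> a point of its slit tangent bundle
  \<open>hat M N\<close>. Since \<open>\<Omega>\<close> pulls back to \<open>\<omega>\<close>, the form \<open>\<Omega>\<close> vanishes on the tangent space of the
  image of \<open>hat M N\<close> exactly if \<open>\<omega>\<close> vanishes on the tangent space of \<open>hat M N\<close>. In a chart in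
  which \<open>N\<close> is a piece of a plane \<open>W\<close>, the set \<open>hat M N\<close> is \<open>W \<times> (W - {0})\<close>, its tangent vectors
  have both components in \<open>W\<close>, and, because the spray is tangent to it, its connection coefficients
  map \<open>W\<close> to \<open>W\<close> (\<open>conn_coeff_totally_geodesic\<close>). So \<open>\<omega> = h\<^sub>i\<^sub>j dx\<^sup>i \<and> \<phi>\<^sup>j\<close> only sees
  \<open>h\<close> on \<open>W\<close> there. As the Liouville field and the spray are characteristic, \<open>h\<close> annihilates
  \<open>y\<close> in both arguments (\<open>h_radical\<close>), and with \<open>W\<close> spanned by \<open>y\<close> and \<open>v\<close> everything reduces to
  the number \<open>h(v, v)\<close>: it is the value of \<open>\<omega>\<close> on a vector above \<open>v\<close> and the vertical vector
  \<open>v\<close>, and all other values are multiples of it.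

  Hence a positive quasi-definite \<open>h\<close> makes \<open>\<omega>\<close> nonzero on \<open>hat M N\<close>
  (\<open>form_nonzero_on_hat\<close>). Conversely, if \<open>\<omega>\<close> never vanishes on such surfaces then, since every plane
  is tangent to one, \<open>h(v, v) \<noteq> 0\<close> whenever \<open>y\<close> and \<open>v\<close> are linearly independent
  (\<open>h_nonzero\<close>). In dimension at least three the linearly independent pairs over a point form a
  connected set, so that \<open>h(v, v)\<close> has one sign over each point
  (\<open>constant_sign_on_independent_pairs\<close>); by continuity this sign is locally constant on \<open>M\<close>, and
  a connected \<open>M\<close> has a single sign (\<open>quasi_definite_of_connected\<close>).

  The value \<open>h(v, w)\<close> is independent of the chart because it is \<open>\<omega>(\<xi>, \<eta>)\<close> for any \<open>\<xi>\<close> projecting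
  to \<open>v\<close> and the vertical lift \<open>\<eta>\<close> of \<open>w\<close>. This is what allows passing from an arbitrary chart to
  one that flattens \<open>N\<close>, and what makes the sign over a point of \<open>M\<close> well defined.\<close>


section \<open>Smooth maps\<close>

lemma k_smooth_on_cong:
  assumes "open S" "\<And>x. x \<in> S \<Longrightarrow> f x = g x" "k_smooth_on k S f"
  shows "k_smooth_on k S g"
  using assms(2,3)
proof (induction k arbitrary: f g)
  case 0
  then show ?case using continuous_on_cong by force
next
  case (Suc k)
  have d: "f differentiable (at x)" if "x \<in> S" for x
    using Suc.prems(2) that by simp
  have D: "(g has_derivative frechet_derivative f (at x)) (at x)" if "x \<in> S" for x
    by (rule has_derivative_transform_within_open[OF _ \<open>open S\<close> that Suc.prems(1)])
      (use d[OF that] frechet_derivative_works in blast)+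
  have *: "g differentiable (at x)" "frechet_derivative f (at x) = frechet_derivative g (at x)"
    if "x \<in> S" for x
    using differentiableI[OF D[OF that]] frechet_derivative_at[OF D[OF that]] by auto
  have "k_smooth_on k S (\<lambda>x. frechet_derivative g (at x) v)" for v
    by (rule Suc.IH[of "\<lambda>x. frechet_derivative f (at x) v"]) (use * Suc.prems(2) in auto)
  with * show ?case by simp
qed

lemma k_smooth_on_const: "k_smooth_on k S (\<lambda>x. c)"
  by (induction k arbitrary: c) auto

lemma k_smooth_on_line: "k_smooth_on k S (\<lambda>t::real. a + t *\<^sub>R v)"
proof (cases k)
  case (Suc k')
  have "((\<lambda>t. a + t *\<^sub>R v) has_derivative (\<lambda>s. s *\<^sub>R v)) (at t)" for t
    by (auto intro!: derivative_eq_intros)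
  then have "(\<lambda>t. a + t *\<^sub>R v) differentiable (at t)"
    "frechet_derivative (\<lambda>t. a + t *\<^sub>R v) (at t) = (\<lambda>s. s *\<^sub>R v)" for t
    by (auto intro: differentiableI simp: frechet_derivative_at[symmetric])
  then show ?thesis by (simp add: Suc k_smooth_on_const)
qed (auto intro!: continuous_intros)

text \<open>Precomposition with a line commutes with differentiation up to inserting the direction of the
  line, so no product or general chain rule for iterated derivatives arises. Lines are the only
  curves that have to be built.\<close>

lemma k_smooth_on_compose_line:
  assumes "open S" "k_smooth_on k S f" "\<And>t. t \<in> T \<Longrightarrow> a + t *\<^sub>R v \<in> S" "open T"
  shows "k_smooth_on k T (\<lambda>t::real. f (a + t *\<^sub>R v))"
  using assms(2)
proof (induction k arbitrary: f)
  case 0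
  have "continuous_on ((\<lambda>t. a + t *\<^sub>R v) ` T) f"
    using 0 assms(3) by (auto intro: continuous_on_subset)
  then show ?case
    by (auto intro!: continuous_on_compose2[of _ f T] continuous_intros)
next
  case (Suc k)
  have D: "((\<lambda>t. f (a + t *\<^sub>R v)) has_derivative
      (\<lambda>s. frechet_derivative f (at (a + t *\<^sub>R v)) (s *\<^sub>R v))) (at t)" if "t \<in> T" for t
  proof -
    have "(f has_derivative frechet_derivative f (at (a + t *\<^sub>R v))) (at (a + t *\<^sub>R v))"
      using Suc.prems assms(3)[OF that] frechet_derivative_works by auto
    moreover have "((\<lambda>t. a + t *\<^sub>R v) has_derivative (\<lambda>s. s *\<^sub>R v)) (at t)"
      by (auto intro!: derivative_eq_intros)
    ultimately show ?thesis
      using has_derivative_compose[of "\<lambda>t. a + t *\<^sub>R v"] by fastforce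
  qed
  have "k_smooth_on k T (\<lambda>t. frechet_derivative (\<lambda>t. f (a + t *\<^sub>R v)) (at t) s)" for s
  proof (rule k_smooth_on_cong[OF \<open>open T\<close>])
    show "k_smooth_on k T (\<lambda>t. frechet_derivative f (at (a + t *\<^sub>R v)) (s *\<^sub>R v))"
      by (rule Suc.IH) (use Suc.prems in simp)
    show "frechet_derivative f (at (a + t *\<^sub>R v)) (s *\<^sub>R v)
        = frechet_derivative (\<lambda>t. f (a + t *\<^sub>R v)) (at t) s" if "t \<in> T" for t
      by (simp add: frechet_derivative_at[OF D[OF that], symmetric])
  qed
  then show ?case using differentiableI[OF D] by simp
qed

lemma k_smooth_on_Pair:
  assumes "open S" "k_smooth_on k S f" "k_smooth_on k S g"
  shows "k_smooth_on k S (\<lambda>x. (f x, g x))"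
  using assms(2,3)
proof (induction k arbitrary: f g)
  case 0
  then show ?case by (auto intro!: continuous_intros)
next
  case (Suc k)
  have D: "((\<lambda>x. (f x, g x)) has_derivative
      (\<lambda>v. (frechet_derivative f (at x) v, frechet_derivative g (at x) v))) (at x)" if "x \<in> S" for x
    using Suc.prems that frechet_derivative_works[of f] frechet_derivative_works[of g]
    by (intro has_derivative_Pair) auto
  have "k_smooth_on k S (\<lambda>x. frechet_derivative (\<lambda>x. (f x, g x)) (at x) v)" for v
  proof (rule k_smooth_on_cong[OF \<open>open S\<close>])
    show "k_smooth_on k S (\<lambda>x. (frechet_derivative f (at x) v, frechet_derivative g (at x) v))"
      by (rule Suc.IH) (use Suc.prems in simp_all)
    show "(frechet_derivative f (at x) v, frechet_derivative g (at x) v)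
        = frechet_derivative (\<lambda>x. (f x, g x)) (at x) v" if "x \<in> S" for x
      by (simp add: frechet_derivative_at[OF D[OF that], symmetric])
  qed
  then show ?case using differentiableI[OF D] by simp
qed

lemma smooth_on_continuous: "smooth_on S f \<Longrightarrow> continuous_on S f"
  unfolding smooth_on_def by (metis k_smooth_on.simps(1))

lemma smooth_on_differentiable: "smooth_on S f \<Longrightarrow> x \<in> S \<Longrightarrow> f differentiable (at x)"
  unfolding smooth_on_def by (metis k_smooth_on.simps(2))

lemma smooth_on_derivative: "smooth_on S f \<Longrightarrow> smooth_on S (\<lambda>x. frechet_derivative f (at x) v)"
  unfolding smooth_on_def by (metis k_smooth_on.simps(2))


text \<open>Pairing with the orthogonal complement of the subspace turns the curve into constant zero
  functions, so their derivatives vanish.\<close>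

lemma vector_derivative_in_subspace:
  fixes f :: "real \<Rightarrow> 'a::euclidean_space"
  assumes W: "subspace W" and f: "(f has_vector_derivative v) (at t)"
    and T: "open T" "t \<in> T" "\<And>s. s \<in> T \<Longrightarrow> f s \<in> W"
  shows "v \<in> W"
proof -
  have "n \<bullet> v = 0" if n: "n \<in> W\<^sup>\<bottom>" for n
  proof -
    have "((\<lambda>s. n \<bullet> f s) has_vector_derivative n \<bullet> v) (at t)"
      by (rule bounded_linear.has_vector_derivative[OF bounded_linear_inner_right f])
    moreover have "((\<lambda>s. n \<bullet> f s) has_vector_derivative 0) (at t)"
    proof (rule has_vector_derivative_transform_within_open[where f = "\<lambda>_. 0"])
      show "0 = n \<bullet> f s" if "s \<in> T" for s
        using n T(3)[OF that] by (simp add: orthogonal_comp_def orthogonal_def inner_commute[of n])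
    qed (use T in auto)
    ultimately show ?thesis using vector_derivative_unique_at by blast
  qed
  then have "v \<in> W\<^sup>\<bottom>\<^sup>\<bottom>"
    unfolding orthogonal_comp_def[of "W\<^sup>\<bottom>"] orthogonal_def by blast
  then show ?thesis by (simp only: orthogonal_comp_self[OF W])
qed


section \<open>Tangent vectors in a differentiable atlas\<close>

text \<open>The part of the manifold axioms that governs tangent vectors. It holds for a smooth manifold and
  also for its slit tangent bundle with the atlas of induced charts, which is not maximal.\<close>

locale differentiable_atlas =
  fixes M :: "('a, 'e::euclidean_space) mfd"
  assumes inj_chart: "c \<in> atlas M \<Longrightarrow> inj_on (cmap c) (cdom c)"
    and open_overlap: "c \<in> atlas M \<Longrightarrow> d \<in> atlas M \<Longrightarrow> open (cmap c ` (cdom c \<inter> cdom d))"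
    and open_chart_domain: "c \<in> atlas M \<Longrightarrow> openin (mtop M) (cdom c)"
    and transition_differentiable:
      "c \<in> atlas M \<Longrightarrow> d \<in> atlas M \<Longrightarrow> p \<in> cdom c \<Longrightarrow> p \<in> cdom d \<Longrightarrow>
        transition c d differentiable (at (cmap c p))"
begin

abbreviation D where "D c d p \<equiv> frechet_derivative (transition c d) (at (cmap c p))"

lemma cinv_cmap: "c \<in> atlas M \<Longrightarrow> p \<in> cdom c \<Longrightarrow> cinv c (cmap c p) = p"
  by (simp add: cinv_def inj_chart)

lemma cmap_cinv: "u \<in> cimg c \<Longrightarrow> cmap c (cinv c u) = u"
  by (simp add: cinv_def cimg_def f_inv_into_f)

lemma cinv_in: "u \<in> cimg c \<Longrightarrow> cinv c u \<in> cdom c"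
  by (simp add: cinv_def cimg_def inv_into_into)

lemma open_cimg: "c \<in> atlas M \<Longrightarrow> open (cimg c)"
  using open_overlap[of c c] by (simp add: cimg_def)

lemma transition_cmap: "c \<in> atlas M \<Longrightarrow> p \<in> cdom c \<Longrightarrow> transition c d (cmap c p) = cmap d p"
  by (simp add: transition_def cinv_cmap)

lemma has_derivative_transition:
  assumes "c \<in> atlas M" "d \<in> atlas M" "p \<in> cdom c" "p \<in> cdom d"
  shows "(transition c d has_derivative D c d p) (at (cmap c p))"
  using transition_differentiable[OF assms] frechet_derivative_works by blast

lemma linear_D:
  assumes "c \<in> atlas M" "d \<in> atlas M" "p \<in> cdom c" "p \<in> cdom d"
  shows "linear (D c d p)"
  using has_derivative_transition[OF assms] has_derivative_linear by blast

lemma D_compose: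
  assumes c: "c \<in> atlas M" "p \<in> cdom c" and d: "d \<in> atlas M" "p \<in> cdom d"
    and e: "e \<in> atlas M" "p \<in> cdom e"
  shows "D d e p (D c d p a) = D c e p a"
proof -
  have p: "transition c d (cmap c p) = cmap d p" by (rule transition_cmap[OF c])
  have 1: "((\<lambda>u. transition d e (transition c d u)) has_derivative (\<lambda>a. D d e p (D c d p a)))
      (at (cmap c p))"
    using has_derivative_compose[OF has_derivative_transition[OF c(1) d(1) c(2) d(2)], of "transition d e"]
      has_derivative_transition[OF d(1) e(1) d(2) e(2)] p by simp
  have "(transition c e has_derivative (\<lambda>a. D d e p (D c d p a))) (at (cmap c p))"
  proof (rule has_derivative_transform_within_open[OF 1 open_overlap[OF c(1) d(1)]])
    show "cmap c p \<in> cmap c ` (cdom c \<inter> cdom d)" using c d by blast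
    show "transition d e (transition c d u) = transition c e u"
      if "u \<in> cmap c ` (cdom c \<inter> cdom d)" for u
      using that c d by (auto simp: transition_cmap)
  qed
  then show ?thesis using frechet_derivative_at by metis
qed

lemma D_same:
  assumes c: "c \<in> atlas M" "p \<in> cdom c"
  shows "D c c p a = a"
proof -
  have "(transition c c has_derivative (\<lambda>a. a)) (at (cmap c p))"
  proof (rule has_derivative_transform_within_open[OF has_derivative_ident open_cimg[OF c(1)]])
    show "cmap c p \<in> cimg c" using c by (simp add: cimg_def)
    show "u = transition c c u" if "u \<in> cimg c" for u
      using cmap_cinv[OF that] by (simp add: transition_def)
  qed
  then show ?thesis using frechet_derivative_at by metis
qed

lemma tangent_spaceI:
  assumes "\<And>c d. c \<in> atlas M \<Longrightarrow> d \<in> atlas M \<Longrightarrow> p \<in> cdom c \<Longrightarrow> p \<in> cdom d \<Longrightarrow>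
      v d = D c d p (v c)"
    and "\<And>c. \<not> (c \<in> atlas M \<and> p \<in> cdom c) \<Longrightarrow> v c = 0"
  shows "v \<in> tangent_space M p"
  using assms unfolding tangent_space_def by blast

lemma tvec_of_self: "c \<in> atlas M \<Longrightarrow> p \<in> cdom c \<Longrightarrow> tvec_of M c p a c = a"
  by (simp add: tvec_of_def D_same)

lemma tvec_of_in_tangent_space:
  "c \<in> atlas M \<Longrightarrow> p \<in> cdom c \<Longrightarrow> tvec_of M c p a \<in> tangent_space M p"
  by (auto simp: tvec_of_def tangent_space_def D_compose)

lemma tangent_space_D:
  "v \<in> tangent_space M p \<Longrightarrow> c \<in> atlas M \<Longrightarrow> p \<in> cdom c \<Longrightarrow> d \<in> atlas M \<Longrightarrow> p \<in> cdom d \<Longrightarrow>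
    v d = D c d p (v c)"
  unfolding tangent_space_def by blast

lemma tvec_of_coord:
  assumes v: "v \<in> tangent_space M p" and c: "c \<in> atlas M" "p \<in> cdom c"
  shows "tvec_of M c p (v c) = v"
proof
  fix d
  show "tvec_of M c p (v c) d = v d"
  proof (cases "d \<in> atlas M \<and> p \<in> cdom d")
    case True
    then show ?thesis using tangent_space_D[OF v c, of d] by (simp add: tvec_of_def)
  next
    case False
    then have "v d = 0" using v unfolding tangent_space_def by blast
    with False show ?thesis by (simp add: tvec_of_def del: de_Morgan_conj)
  qed
qed

lemma tangent_vector_eqI:
  assumes "v \<in> tangent_space M p" "w \<in> tangent_space M p" "c \<in> atlas M" "p \<in> cdom c" "v c = w c"
  shows "v = w"
  by (rule trans[OF tvec_of_coord[OF assms(1,3,4), symmetric]])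
    (simp only: assms(5) tvec_of_coord[OF assms(2,3,4)])

lemma zero_in_tangent_space: "(\<lambda>_. 0) \<in> tangent_space M p"
  by (auto simp: tangent_space_def linear_0[OF linear_D])

lemma tangent_space_combination:
  assumes "v \<in> tangent_space M p" "w \<in> tangent_space M p"
  shows "(\<lambda>c. a *\<^sub>R v c + b *\<^sub>R w c) \<in> tangent_space M p"
proof (rule tangent_spaceI)
  fix c d assume c: "c \<in> atlas M" "d \<in> atlas M" "p \<in> cdom c" "p \<in> cdom d"
  then have "v d = D c d p (v c)" "w d = D c d p (w c)"
    using tangent_space_D assms by blast+
  then show "a *\<^sub>R v d + b *\<^sub>R w d = D c d p (a *\<^sub>R v c + b *\<^sub>R w c)"
    using linear_D[OF c] by (simp add: linear_add linear_scale)
next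
  fix c assume "\<not> (c \<in> atlas M \<and> p \<in> cdom c)"
  then have "v c = 0" "w c = 0" using assms unfolding tangent_space_def by blast+
  then show "a *\<^sub>R v c + b *\<^sub>R w c = 0" by simp
qed

lemma open_curve_chart_domain:
  assumes "smooth_curve M I \<gamma>" "open I" "c \<in> atlas M"
  shows "open {t \<in> I. \<gamma> t \<in> cdom c}"
proof -
  have "openin (top_of_set I) {t \<in> topspace (top_of_set I). \<gamma> t \<in> cdom c}"
    using assms(1) open_chart_domain[OF assms(3)] unfolding smooth_curve_def
    by (intro openin_continuous_map_preimage) auto
  then show ?thesis using \<open>open I\<close> by (simp add: openin_open_eq)
qed

lemma curve_has_vector_derivative:
  assumes "smooth_curve M I \<gamma>" "t \<in> I" "c \<in> atlas M" "\<gamma> t \<in> cdom c"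
  shows "((cmap c \<circ> \<gamma>) has_vector_derivative velocity M \<gamma> t c) (at t)"
proof -
  have "smooth_on {t \<in> I. \<gamma> t \<in> cdom c} (cmap c \<circ> \<gamma>)"
    using assms unfolding smooth_curve_def by blast
  then have "(cmap c \<circ> \<gamma>) differentiable (at t)"
    using smooth_on_differentiable assms by blast
  then show ?thesis using assms by (simp add: velocity_def vector_derivative_works)
qed

lemma velocity_in_tangent_space:
  assumes \<gamma>: "smooth_curve M I \<gamma>" "open I" and t: "t \<in> I"
  shows "velocity M \<gamma> t \<in> tangent_space M (\<gamma> t)"
proof -
  have "velocity M \<gamma> t d = D c d (\<gamma> t) (velocity M \<gamma> t c)"
    if c: "c \<in> atlas M" and d: "d \<in> atlas M" and "\<gamma> t \<in> cdom c" "\<gamma> t \<in> cdom d" for c d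
  proof -
    let ?v = "velocity M \<gamma> t c"
    have "((cmap c \<circ> \<gamma>) has_vector_derivative ?v) (at t)"
      by (rule curve_has_vector_derivative[OF \<gamma>(1) t]) (use that in auto)
    then have 1: "((\<lambda>s. transition c d ((cmap c \<circ> \<gamma>) s)) has_vector_derivative D c d (\<gamma> t) ?v) (at t)"
      using has_derivative_compose[of "cmap c \<circ> \<gamma>" "\<lambda>s. s *\<^sub>R ?v" t UNIV "transition c d"
          "D c d (\<gamma> t)"] has_derivative_transition[OF c d that(3) that(4)]
      by (simp add: has_vector_derivative_def linear_scale[OF linear_D[OF c d that(3) that(4)]])
    have "((cmap d \<circ> \<gamma>) has_vector_derivative D c d (\<gamma> t) ?v) (at t)"
      by (rule has_vector_derivative_transform_within_open[OF 1 open_curve_chart_domain[OF \<gamma> c]])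
        (use that t in \<open>auto simp: transition_cmap\<close>)
    moreover have "velocity M \<gamma> t d = vector_derivative (cmap d \<circ> \<gamma>) (at t)"
      using that by (simp add: velocity_def)
    ultimately show ?thesis using vector_derivative_at by metis
  qed
  then show ?thesis by (rule tangent_spaceI) (auto simp: velocity_def)
qed

text \<open>Read in the chart \<open>c\<close>, a curve in \<open>S\<close> runs inside \<open>W\<close>, and so does its derivative.\<close>

lemma tangent_to_in_subspace:
  assumes \<xi>: "\<xi> \<in> tangent_to M S p" and c: "c \<in> atlas M" "p \<in> cdom c"
    and W: "subspace W" "\<And>q. q \<in> S \<Longrightarrow> q \<in> cdom c \<Longrightarrow> cmap c q \<in> W"
  shows "\<xi> c \<in> W"
proof -
  obtain \<gamma> \<epsilon> where \<gamma>: "\<xi> = velocity M \<gamma> 0" "\<epsilon> > 0" "\<gamma> 0 = p" "\<gamma> ` {-\<epsilon><..<\<epsilon>} \<subseteq> S"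
      "smooth_curve M {-\<epsilon><..<\<epsilon>} \<gamma>"
    using \<xi> unfolding tangent_to_def by blast
  let ?T = "{t \<in> {-\<epsilon><..<\<epsilon>}. \<gamma> t \<in> cdom c}"
  have "((cmap c \<circ> \<gamma>) has_vector_derivative \<xi> c) (at 0)"
    using curve_has_vector_derivative[OF \<gamma>(5), of 0 c] \<gamma> c by simp
  moreover have "open ?T" using open_curve_chart_domain[OF \<gamma>(5)] c by simp
  moreover have "(cmap c \<circ> \<gamma>) s \<in> W" if "s \<in> ?T" for s
    using that \<gamma>(4) W(2)[of "\<gamma> s"] by (auto simp: image_subset_iff)
  ultimately show ?thesis
    using vector_derivative_in_subspace[OF W(1), of "cmap c \<circ> \<gamma>" "\<xi> c" 0 ?T] \<gamma>(2,3) c by simp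
qed

lemma tangent_to_subset_tangent_space: "tangent_to M S p \<subseteq> tangent_space M p"
  using velocity_in_tangent_space unfolding tangent_to_def by fastforce

end

section \<open>Charts of a smooth manifold and of its slit tangent bundle\<close>

lemma linear_Basis_expansion:
  fixes w :: "'a::euclidean_space"
  assumes "linear f"
  shows "(\<Sum>e\<in>Basis. (w \<bullet> e) *\<^sub>R f e) = f w"
proof -
  have "f w = f (\<Sum>e\<in>Basis. (w \<bullet> e) *\<^sub>R e)" by (simp add: euclidean_representation)
  also have "\<dots> = (\<Sum>e\<in>Basis. (w \<bullet> e) *\<^sub>R f e)"
    by (simp only: linear_sum[OF assms] linear_scale[OF assms] o_def)
  finally show ?thesis by simp
qed

locale smooth_mfd =
  fixes M :: "('m, 'e::euclidean_space) mfd"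
  assumes smooth_manifold: "smooth_manifold M"
begin

lemma homeomorphic_chart:
  "c \<in> atlas M \<Longrightarrow> homeomorphic_map (subtopology (mtop M) (cdom c)) (top_of_set (cimg c)) (cmap c)"
  using smooth_manifold unfolding smooth_manifold_def top_chart_def by blast

lemma openin_cdom: "c \<in> atlas M \<Longrightarrow> openin (mtop M) (cdom c)"
  using smooth_manifold unfolding smooth_manifold_def top_chart_def by blast

lemma topspace_chart_domain: "c \<in> atlas M \<Longrightarrow> topspace (subtopology (mtop M) (cdom c)) = cdom c"
  using openin_subset[OF openin_cdom[of c]] by (simp add: Int_absorb1)

lemma open_chart_image:
  assumes "c \<in> atlas M" "openin (mtop M) U" "U \<subseteq> cdom c"
  shows "open (cmap c ` U)"
proof -
  have "openin (top_of_set (cimg c)) (cmap c ` U)"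
    using homeomorphic_map_openness[OF homeomorphic_chart[OF assms(1)], of U] assms
      openin_subset[OF assms(2)]
    by (simp add: topspace_chart_domain openin_subtopology_Int2 openin_cdom openin_open_subtopology)
  moreover have "open (cimg c)"
    using assms smooth_manifold unfolding smooth_manifold_def top_chart_def by blast
  ultimately show ?thesis using openin_open_eq by blast
qed

lemma transition_smooth:
  "c \<in> atlas M \<Longrightarrow> d \<in> atlas M \<Longrightarrow> smooth_on (cmap c ` (cdom c \<inter> cdom d)) (transition c d)"
  using smooth_manifold unfolding smooth_manifold_def compatible_def by blast

end

sublocale smooth_mfd \<subseteq> differentiable_atlas M
proof
  fix c d assume c: "c \<in> atlas M"
  show "inj_on (cmap c) (cdom c)"
    using homeomorphic_chart[OF c] topspace_chart_domain[OF c]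
    unfolding homeomorphic_eq_everything_map by simp
  show "openin (mtop M) (cdom c)" by (rule openin_cdom[OF c])
  assume d: "d \<in> atlas M"
  show "open (cmap c ` (cdom c \<inter> cdom d))"
    by (rule open_chart_image[OF c openin_Int[OF openin_cdom[OF c] openin_cdom[OF d]]]) auto
  show "transition c d differentiable (at (cmap c p))" if "p \<in> cdom c" "p \<in> cdom d" for p
    using smooth_on_differentiable[OF transition_smooth[OF c d]] that by blast
qed

context smooth_mfd
begin

lemma continuous_cmap:
  "c \<in> atlas M \<Longrightarrow> continuous_map (subtopology (mtop M) (cdom c)) (top_of_set (cimg c)) (cmap c)"
  using homeomorphic_chart homeomorphic_imp_continuous_map by blast

lemma continuous_cinv:
  assumes c: "c \<in> atlas M"
  shows "continuous_map (top_of_set (cimg c)) (mtop M) (cinv c)"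
proof -
  obtain g where g: "homeomorphic_maps (subtopology (mtop M) (cdom c)) (top_of_set (cimg c)) (cmap c) g"
    using homeomorphic_chart[OF c] homeomorphic_map_maps by blast
  then have "continuous_map (top_of_set (cimg c)) (mtop M) g"
    unfolding homeomorphic_maps_def by (simp add: continuous_map_in_subtopology)
  then show ?thesis
  proof (rule continuous_map_eq)
    fix u assume "u \<in> topspace (top_of_set (cimg c))"
    then have "cmap c (cinv c u) = u" "cinv c u \<in> cdom c"
      using cmap_cinv[of u c] cinv_in[of u c] by simp_all
    then show "g u = cinv c u"
      using g topspace_chart_domain[OF c] unfolding homeomorphic_maps_def by metis
  qed
qed

lemma chart_at: "p \<in> points M \<Longrightarrow> \<exists>c\<in>atlas M. p \<in> cdom c"
  using smooth_manifold unfolding smooth_manifold_def by blast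

lemma cdom_subset: "c \<in> atlas M \<Longrightarrow> cdom c \<subseteq> points M"
  using openin_subset[OF openin_cdom] .

lemma transition_cinv_cmap: "transition c d u = cmap d (cinv c u)"
  by (simp add: transition_def)

lemma overlap_image:
  assumes "c \<in> atlas M"
  shows "u \<in> cmap c ` (cdom c \<inter> cdom d) \<longleftrightarrow> u \<in> cimg c \<and> cinv c u \<in> cdom d"
proof
  assume "u \<in> cmap c ` (cdom c \<inter> cdom d)"
  then obtain p where "u = cmap c p" "p \<in> cdom c" "p \<in> cdom d" by blast
  then show "u \<in> cimg c \<and> cinv c u \<in> cdom d"
    using assms by (simp add: cinv_cmap cimg_def)
next
  assume u: "u \<in> cimg c \<and> cinv c u \<in> cdom d"
  then have "u = cmap c (cinv c u)" "cinv c u \<in> cdom c \<inter> cdom d"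
    using cmap_cinv[of u c] cinv_in[of u c] by simp_all
  then show "u \<in> cmap c ` (cdom c \<inter> cdom d)" by blast
qed

abbreviation slit where "slit \<equiv> slit_bundle M"
abbreviation lift where "lift \<equiv> lift_chart M"

lemma atlas_slit: "atlas slit = lift ` atlas M"
  by (simp add: slit_bundle_def)

lemma lift_in_atlas [simp]: "c \<in> atlas M \<Longrightarrow> lift c \<in> atlas slit"
  by (simp add: atlas_slit)

lemma in_cdom_lift: "z \<in> cdom (lift c) \<longleftrightarrow> z \<in> slit_points M \<and> fst z \<in> cdom c"
  by (auto simp: lift_chart_def)

lemma cmap_lift: "cmap (lift c) z = (cmap c (fst z), snd z c)"
  by (simp add: lift_chart_def case_prod_beta)

lemma slit_pointsD:
  assumes "z \<in> slit_points M"
  shows "fst z \<in> points M" "snd z \<in> tangent_space M (fst z)" "snd z \<noteq> (\<lambda>_. 0)"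
  using assms by (auto simp: slit_points_def)

lemma slit_coord_nonzero:
  assumes "z \<in> slit_points M" "c \<in> atlas M" "fst z \<in> cdom c"
  shows "snd z c \<noteq> 0"
  using tangent_vector_eqI[OF slit_pointsD(2)[OF assms(1)] zero_in_tangent_space assms(2,3)]
    slit_pointsD(3)[OF assms(1)] by blast

lemma tvec_of_slit_point:
  assumes c: "c \<in> atlas M" "p \<in> cdom c" and w: "w \<noteq> 0"
  shows "(p, tvec_of M c p w) \<in> slit_points M"
proof -
  have "tvec_of M c p w \<noteq> (\<lambda>_. 0)" using tvec_of_self[OF c, of w] w by metis
  then show ?thesis
    using tvec_of_in_tangent_space[OF c] cdom_subset[OF c(1)] c(2) by (auto simp: slit_points_def)
qed

lemma lift_image:
  assumes c: "c \<in> atlas M"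
  shows "cmap (lift c) ` {z \<in> slit_points M. fst z \<in> cdom c \<inter> U} = cmap c ` (cdom c \<inter> U) \<times> (UNIV - {0})"
proof (intro subset_antisym subsetI)
  fix a assume "a \<in> cmap (lift c) ` {z \<in> slit_points M. fst z \<in> cdom c \<inter> U}"
  then show "a \<in> cmap c ` (cdom c \<inter> U) \<times> (UNIV - {0})"
    using slit_coord_nonzero[OF _ c] by (auto simp: cmap_lift)
next
  fix a assume "a \<in> cmap c ` (cdom c \<inter> U) \<times> (UNIV - {0 :: 'e})"
  then obtain p and w :: 'e where p: "a = (cmap c p, w)" "p \<in> cdom c" "p \<in> U" "w \<noteq> 0" by auto
  have "a = cmap (lift c) (p, tvec_of M c p w)"
    using tvec_of_self[OF c p(2)] p by (simp add: cmap_lift)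
  then show "a \<in> cmap (lift c) ` {z \<in> slit_points M. fst z \<in> cdom c \<inter> U}"
    using tvec_of_slit_point[OF c p(2,4)] p by (intro image_eqI) auto
qed

lemma cimg_lift:
  assumes "c \<in> atlas M"
  shows "cimg (lift c) = cimg c \<times> (UNIV - {0})"
  using lift_image[OF assms, of UNIV] by (simp add: cimg_def in_cdom_lift set_eq_iff image_iff Bex_def)

lemma inj_lift:
  assumes c: "c \<in> atlas M"
  shows "inj_on (cmap (lift c)) (cdom (lift c))"
proof (rule inj_onI)
  fix z z' assume z: "z \<in> cdom (lift c)" "z' \<in> cdom (lift c)" "cmap (lift c) z = cmap (lift c) z'"
  then have "fst z = fst z'"
    using inj_onD[OF inj_chart[OF c]] by (simp add: cmap_lift in_cdom_lift)
  moreover have "snd z = snd z'"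
    using tangent_vector_eqI[OF slit_pointsD(2) _ c, of z "snd z'"] slit_pointsD(2)[of z'] z \<open>fst z = fst z'\<close>
    by (simp add: cmap_lift in_cdom_lift)
  ultimately show "z = z'" by (rule prod_eqI)
qed

lemma cinv_lift:
  assumes c: "c \<in> atlas M" and u: "(u, w) \<in> cimg (lift c)"
  shows "cinv (lift c) (u, w) = (cinv c u, tvec_of M c (cinv c u) w)"
proof -
  have u': "u \<in> cimg c" "w \<noteq> 0" using u cimg_lift[OF c] by auto
  have p: "cinv c u \<in> cdom c" using cinv_in[OF u'(1)] .
  have "cmap (lift c) (cinv c u, tvec_of M c (cinv c u) w) = (u, w)"
    using cmap_cinv[OF u'(1)] tvec_of_self[OF c p] by (simp add: cmap_lift)
  moreover have "(cinv c u, tvec_of M c (cinv c u) w) \<in> cdom (lift c)"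
    using tvec_of_slit_point[OF c p u'(2)] p by (simp add: in_cdom_lift)
  ultimately show ?thesis
    using inv_into_f_f[OF inj_lift[OF c]] unfolding cinv_def[of "lift c"] by metis
qed

lemma transition_lift:
  assumes c: "c \<in> atlas M" and d: "d \<in> atlas M" "cinv c u \<in> cdom d" and u: "(u, w) \<in> cimg (lift c)"
  shows "transition (lift c) (lift d) (u, w) =
    (transition c d u, frechet_derivative (transition c d) (at u) w)"
  using d cinv_lift[OF c u] cmap_cinv[of u c] u cimg_lift[OF c]
  by (simp add: transition_def[of "lift c"] cmap_lift tvec_of_def transition_cinv_cmap)

text \<open>The derivative of \<open>(u, w) \<mapsto> (\<tau> u, D\<tau>(u) w)\<close> is block triangular with both diagonal
  blocks equal to \<open>D\<tau>\<close>. The off-diagonal block involves second derivatives; all that is needed is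
  that it depends on the base component alone.\<close>

lemma has_derivative_transition_lift:
  assumes c: "c \<in> atlas M" "fst z \<in> cdom c" and d: "d \<in> atlas M" "fst z \<in> cdom d"
    and z: "z \<in> slit_points M"
  obtains K where "K 0 = 0"
    "(transition (lift c) (lift d) has_derivative
       (\<lambda>(a, b). (D c d (fst z) a, D c d (fst z) b + K a))) (at (cmap (lift c) z))"
proof -
  let ?u = "cmap c (fst z)" and ?w = "snd z c" and ?S = "cmap c ` (cdom c \<inter> cdom d)"
  define G where "G = (\<lambda>e. frechet_derivative (\<lambda>x. frechet_derivative (transition c d) (at x) e) (at ?u))"
  define K where "K = (\<lambda>a. \<Sum>e\<in>Basis. (?w \<bullet> e) *\<^sub>R G e a)"
  have uS: "?u \<in> ?S" using c d by blast
  have G: "((\<lambda>x. frechet_derivative (transition c d) (at x) e) has_derivative G e) (at ?u)" for e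
    using smooth_on_differentiable[OF smooth_on_derivative[OF transition_smooth[OF c(1) d(1)]] uS]
      frechet_derivative_works unfolding G_def by blast
  have tau: "(transition c d has_derivative D c d (fst z)) (at ?u)"
    using has_derivative_transition c d by blast
  have lin: "linear (D c d (fst z))" using linear_D c d by blast
  have K0: "K 0 = 0"
    using linear_0[OF has_derivative_linear[OF G]] by (simp add: K_def)
  have fst: "(fst has_derivative fst) (at (?u, ?w))" by (auto intro!: derivative_eq_intros)
  have 1: "((\<lambda>x. transition c d (fst x)) has_derivative (\<lambda>x. D c d (fst z) (fst x))) (at (?u, ?w))"
    using has_derivative_compose[OF fst, of "transition c d"]
      tau by simp
  have 2: "((\<lambda>x. frechet_derivative (transition c d) (at (fst x)) e) has_derivative (\<lambda>x. G e (fst x)))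
      (at (?u, ?w))" for e
    using has_derivative_compose[OF fst, of "\<lambda>x. frechet_derivative (transition c d) (at x) e"] G by simp
  have "((\<lambda>x. \<Sum>e\<in>Basis. (snd x \<bullet> e) *\<^sub>R frechet_derivative (transition c d) (at (fst x)) e)
      has_derivative (\<lambda>x. \<Sum>e\<in>Basis. (?w \<bullet> e) *\<^sub>R G e (fst x) + (snd x \<bullet> e) *\<^sub>R D c d (fst z) e))
      (at (?u, ?w))"
    by (rule has_derivative_sum) (auto intro!: derivative_eq_intros 2)
  moreover have "(\<Sum>e\<in>Basis. (b \<bullet> e) *\<^sub>R D c d (fst z) e) = D c d (fst z) b" for b
    by (rule linear_Basis_expansion[OF lin])
  ultimately have 3: "((\<lambda>x. \<Sum>e\<in>Basis. (snd x \<bullet> e) *\<^sub>R frechet_derivative (transition c d) (at (fst x)) e)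
      has_derivative (\<lambda>x. D c d (fst z) (snd x) + K (fst x))) (at (?u, ?w))"
    by (simp add: sum.distrib K_def add.commute)
  have 4: "((\<lambda>x. (transition c d (fst x),
        \<Sum>e\<in>Basis. (snd x \<bullet> e) *\<^sub>R frechet_derivative (transition c d) (at (fst x)) e))
      has_derivative (\<lambda>(a, b). (D c d (fst z) a, D c d (fst z) b + K a))) (at (?u, ?w))"
    using has_derivative_Pair[OF 1 3] by (simp add: case_prod_beta')
  have "(transition (lift c) (lift d) has_derivative
       (\<lambda>(a, b). (D c d (fst z) a, D c d (fst z) b + K a))) (at (?u, ?w))"
  proof (rule has_derivative_transform_within_open[OF 4])
    show "open (?S \<times> (UNIV - {0::'e}))"
      by (intro open_Times open_overlap c d) auto
    show "(?u, ?w) \<in> ?S \<times> (UNIV - {0})" using uS slit_coord_nonzero[OF z c] by blast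
    fix x assume x: "x \<in> ?S \<times> (UNIV - {0 :: 'e})"
    then have x1: "fst x \<in> cimg c" "cinv c (fst x) \<in> cdom d" "(fst x, snd x) \<in> cimg (lift c)"
      using overlap_image[OF c(1), of "fst x" d] cimg_lift[OF c(1)] by (auto simp: mem_Times_iff)
    have "linear (frechet_derivative (transition c d) (at (fst x)))"
      using linear_D[OF c(1) d(1) cinv_in x1(2)] cmap_cinv x1(1) by metis
    then have "(\<Sum>e\<in>Basis. (snd x \<bullet> e) *\<^sub>R frechet_derivative (transition c d) (at (fst x)) e)
        = frechet_derivative (transition c d) (at (fst x)) (snd x)"
      by (rule linear_Basis_expansion)
    then show "(transition c d (fst x),
        \<Sum>e\<in>Basis. (snd x \<bullet> e) *\<^sub>R frechet_derivative (transition c d) (at (fst x)) e)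
        = transition (lift c) (lift d) x"
      using transition_lift[OF c(1) d(1) x1(2,3)] by simp
  qed
  with K0 show ?thesis by (intro that[of K]) (simp_all only: cmap_lift)
qed

lemma openin_lift:
  assumes "c \<in> atlas M"
  shows "openin (mtop slit) (cdom (lift c))"
proof -
  have "cdom (lift c) = {z \<in> cdom (lift c). cmap (lift c) z \<in> UNIV}" by simp
  then show ?thesis
    unfolding slit_bundle_def mfd.simps using assms open_UNIV
    by (intro topology_generated_by_Basis) blast
qed

end

sublocale smooth_mfd \<subseteq> slit: differentiable_atlas "slit_bundle M"
proof
  fix C C' assume "C \<in> atlas (slit_bundle M)"
  then obtain c where c: "c \<in> atlas M" "C = lift c" using atlas_slit by auto
  show "inj_on (cmap C) (cdom C)" "openin (mtop (slit_bundle M)) (cdom C)"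
    using inj_lift openin_lift c by auto
  assume "C' \<in> atlas (slit_bundle M)"
  then obtain d where d: "d \<in> atlas M" "C' = lift d" using atlas_slit by auto
  have "cdom C \<inter> cdom C' = {z \<in> slit_points M. fst z \<in> cdom c \<inter> cdom d}"
    using c d by (auto simp: in_cdom_lift)
  then have "cmap C ` (cdom C \<inter> cdom C') = cmap c ` (cdom c \<inter> cdom d) \<times> (UNIV - {0})"
    using lift_image[OF c(1)] c(2) by simp
  then show "open (cmap C ` (cdom C \<inter> cdom C'))"
    using open_overlap[OF c(1) d(1)] by (simp add: open_Times open_Diff)
  fix z assume "z \<in> cdom C" "z \<in> cdom C'"
  then have z: "fst z \<in> cdom c" "fst z \<in> cdom d" "z \<in> slit_points M"
    using c d by (auto simp: in_cdom_lift)
  show "transition C C' differentiable (at (cmap C z))"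
    by (rule has_derivative_transition_lift[OF c(1) z(1) d(1) z(2,3)])
      (simp only: c(2) d(2) differentiableI)
qed

context smooth_mfd
begin

lemma slit_tangent_fst:
  assumes \<xi>: "\<xi> \<in> tangent_space slit z" and z: "z \<in> slit_points M"
    and c: "c \<in> atlas M" "fst z \<in> cdom c" and d: "d \<in> atlas M" "fst z \<in> cdom d"
  shows "fst (\<xi> (lift d)) = D c d (fst z) (fst (\<xi> (lift c)))"
proof -
  obtain K where K: "(transition (lift c) (lift d) has_derivative
       (\<lambda>(a, b). (D c d (fst z) a, D c d (fst z) b + K a))) (at (cmap (lift c) z))"
    using has_derivative_transition_lift[OF c d z] .
  have "\<xi> (lift d) = slit.D (lift c) (lift d) z (\<xi> (lift c))"
    using slit.tangent_space_D[OF \<xi>, of "lift c" "lift d"] z c d by (simp add: in_cdom_lift)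
  then show ?thesis by (simp add: case_prod_beta flip: frechet_derivative_at[OF K])
qed

lemma slit_tangent_vertical:
  assumes \<eta>: "\<eta> \<in> tangent_space slit z" and z: "z \<in> slit_points M"
    and c: "c \<in> atlas M" "fst z \<in> cdom c" and d: "d \<in> atlas M" "fst z \<in> cdom d"
    and v: "\<eta> (lift c) = (0, w)"
  shows "\<eta> (lift d) = (0, D c d (fst z) w)"
proof -
  obtain K where K: "K 0 = 0" "(transition (lift c) (lift d) has_derivative
       (\<lambda>(a, b). (D c d (fst z) a, D c d (fst z) b + K a))) (at (cmap (lift c) z))"
    using has_derivative_transition_lift[OF c d z] .
  have "\<eta> (lift d) = slit.D (lift c) (lift d) z (\<eta> (lift c))"
    using slit.tangent_space_D[OF \<eta>, of "lift c" "lift d"] z c d by (simp add: in_cdom_lift)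
  moreover have "linear (D c d (fst z))" using linear_D c d by blast
  ultimately show ?thesis
    using K v by (simp add: linear_0 flip: frechet_derivative_at[OF K(2)])
qed

end

section \<open>Submanifolds in flattening charts\<close>

context differentiable_atlas
begin

lemma velocity_coordinate_line:
  assumes c: "c \<in> atlas M" and I: "open I" "0 \<in> I" "\<And>t. t \<in> I \<Longrightarrow> u + t *\<^sub>R a \<in> cimg c"
  shows "velocity M (\<lambda>t. cinv c (u + t *\<^sub>R a)) 0 c = a"
proof -
  have 1: "((\<lambda>t. u + t *\<^sub>R a) has_vector_derivative a) (at 0)"
    by (auto intro!: derivative_eq_intros)
  have "((cmap c \<circ> (\<lambda>t. cinv c (u + t *\<^sub>R a))) has_vector_derivative a) (at 0)"
    by (rule has_vector_derivative_transform_within_open[OF 1 I(1,2)])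
      (use I(3) in \<open>simp add: cmap_cinv\<close>)
  moreover have "cinv c u \<in> cdom c" using cinv_in I(2) I(3)[of 0] by simp
  ultimately show ?thesis using c by (simp add: velocity_def vector_derivative_at)
qed

end

lemma coordinate_line_interval:
  fixes u a :: "'a::real_normed_vector"
  assumes "open U" "u \<in> U"
  obtains \<epsilon> :: real where "\<epsilon> > 0" "\<And>t. t \<in> {-\<epsilon><..<\<epsilon>} \<Longrightarrow> u + t *\<^sub>R a \<in> U"
proof -
  have "open ((\<lambda>t::real. u + t *\<^sub>R a) -` U)"
    by (rule open_vimage[OF assms(1)]) (intro continuous_intros)
  moreover have "0 \<in> (\<lambda>t::real. u + t *\<^sub>R a) -` U" using assms(2) by simp
  ultimately obtain \<epsilon> where \<epsilon>: "\<epsilon> > 0" "ball 0 \<epsilon> \<subseteq> (\<lambda>t::real. u + t *\<^sub>R a) -` U" by (rule openE)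
  have "u + t *\<^sub>R a \<in> U" if "t \<in> {-\<epsilon><..<\<epsilon>}" for t
  proof -
    have "t \<in> ball 0 \<epsilon>" using that by (simp add: dist_real_def abs_less_iff)
    then show ?thesis using \<epsilon>(2) by blast
  qed
  then show ?thesis by (rule that[OF \<epsilon>(1)])
qed

context smooth_mfd
begin

lemma smooth_coordinate_line:
  assumes c: "c \<in> atlas M" and I: "open I" "\<And>t. t \<in> I \<Longrightarrow> u + t *\<^sub>R a \<in> cimg c"
  shows "smooth_curve M I (\<lambda>t. cinv c (u + t *\<^sub>R a))"
  unfolding smooth_curve_def
proof (intro conjI ballI)
  have "continuous_map (top_of_set I) (top_of_set (cimg c)) (\<lambda>t. u + t *\<^sub>R a)"
    using I(2) by (auto simp: continuous_map_in_subtopology intro!: continuous_intros)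
  from continuous_map_compose[OF this continuous_cinv[OF c]]
  show "continuous_map (top_of_set I) (mtop M) (\<lambda>t. cinv c (u + t *\<^sub>R a))"
    by (simp add: o_def)
  fix d assume d: "d \<in> atlas M"
  let ?S = "cmap c ` (cdom c \<inter> cdom d)" and ?T = "{t \<in> I. cinv c (u + t *\<^sub>R a) \<in> cdom d}"
  have T: "t \<in> ?T \<longleftrightarrow> t \<in> I \<and> u + t *\<^sub>R a \<in> ?S" for t
    using overlap_image[OF c, of "u + t *\<^sub>R a" d] I(2)[of t] by blast
  then have "?T = I \<inter> (\<lambda>t. u + t *\<^sub>R a) -` ?S" by blast
  moreover have "open ((\<lambda>t. u + t *\<^sub>R a) -` ?S)"
    by (rule open_vimage[OF open_overlap[OF c d]]) (intro continuous_intros)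
  ultimately have "open ?T" using I(1) by (simp add: open_Int)
  then have "k_smooth_on k ?T (\<lambda>t. transition c d (u + t *\<^sub>R a))" for k
    using T transition_smooth[OF c d] unfolding smooth_on_def
    by (intro k_smooth_on_compose_line[OF open_overlap[OF c d]]) blast+
  then show "smooth_on ?T (cmap d \<circ> (\<lambda>t. cinv c (u + t *\<^sub>R a)))"
    by (simp add: smooth_on_def transition_def o_def)
qed

text \<open>The topology of the slit tangent bundle is generated by its charts, so continuity of a curve
  can be tested in coordinates.\<close>

lemma smooth_curve_slitI:
  assumes I: "open I" "\<gamma> ` I \<subseteq> slit_points M"
    and T: "\<And>d. d \<in> atlas M \<Longrightarrow> open {t \<in> I. \<gamma> t \<in> cdom (lift d)}"
    and smooth: "\<And>d. d \<in> atlas M \<Longrightarrow> smooth_on {t \<in> I. \<gamma> t \<in> cdom (lift d)} (cmap (lift d) \<circ> \<gamma>)"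
  shows "smooth_curve slit I \<gamma>"
  unfolding smooth_curve_def
proof (intro conjI ballI)
  show "continuous_map (top_of_set I) (mtop slit) \<gamma>"
    unfolding slit_bundle_def mfd.simps
  proof (rule continuous_on_generated_topo)
    fix U assume "U \<in> {{z \<in> cdom (lift c). cmap (lift c) z \<in> T} |c T. c \<in> atlas M \<and> open T}"
    then obtain d T' where d: "U = {z \<in> cdom (lift d). cmap (lift d) z \<in> T'}" "d \<in> atlas M" "open T'"
      by blast
    have "\<gamma> -` U \<inter> I = {t \<in> I. \<gamma> t \<in> cdom (lift d)} \<inter> (cmap (lift d) \<circ> \<gamma>) -` T'"
      using d(1) by auto
    moreover have "open ({t \<in> I. \<gamma> t \<in> cdom (lift d)} \<inter> (cmap (lift d) \<circ> \<gamma>) -` T')"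
      by (rule continuous_open_preimage[OF smooth_on_continuous[OF smooth[OF d(2)]] T[OF d(2)] d(3)])
    ultimately show "openin (top_of_set I) (\<gamma> -` U \<inter> topspace (top_of_set I))"
      using I(1) by (auto simp: openin_open_eq)
  next
    have "\<exists>c\<in>atlas M. \<gamma> t \<in> cdom (lift c)" if "t \<in> I" for t
    proof -
      have "\<gamma> t \<in> slit_points M" using I(2) that by blast
      with chart_at[OF slit_pointsD(1)[OF this]] show ?thesis by (simp add: in_cdom_lift)
    qed
    then have cover: "\<forall>z\<in>\<gamma> ` I. \<exists>c\<in>atlas M. z \<in> cdom (lift c)" by blast
    have "z \<in> \<Union> {{z \<in> cdom (lift c). cmap (lift c) z \<in> T} |c T. c \<in> atlas M \<and> open T}"
      if z: "z \<in> \<gamma> ` I" for z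
    proof -
      obtain c where "c \<in> atlas M" "z \<in> {z \<in> cdom (lift c). cmap (lift c) z \<in> UNIV}"
        using bspec[OF cover z] by blast
      then show ?thesis using open_UNIV by blast
    qed
    then show "\<gamma> ` topspace (top_of_set I)
        \<subseteq> \<Union> {{z \<in> cdom (lift c). cmap (lift c) z \<in> T} |c T. c \<in> atlas M \<and> open T}"
      by (simp only: topspace_euclidean_subtopology subsetI)
  qed
  fix C assume "C \<in> atlas slit"
  then show "smooth_on {t \<in> I. \<gamma> t \<in> cdom C} (cmap C \<circ> \<gamma>)"
    using smooth by (auto simp: atlas_slit)
qed

text \<open>In another chart a coordinate line of \<open>lift c\<close> with direction \<open>(a, b)\<close> reads
  \<open>t \<mapsto> (\<tau>(u + t a), D\<tau>(u + t a)(w + t b))\<close>. Restricting to directions in the base or in the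
  fibre keeps the second component free of products.\<close>

lemma smooth_coordinate_line_slit:
  assumes c: "c \<in> atlas M" and ab: "a = 0 \<or> b = 0"
    and I: "open I" "\<And>t. t \<in> I \<Longrightarrow> (u, w) + t *\<^sub>R (a, b) \<in> cimg (lift c)"
  shows "smooth_curve slit I (\<lambda>t. cinv (lift c) ((u, w) + t *\<^sub>R (a, b)))" (is "smooth_curve _ _ ?\<gamma>")
proof (rule smooth_curve_slitI[OF I(1)])
  have in_c: "?\<gamma> t \<in> cdom (lift c)" if "t \<in> I" for t
    using slit.cinv_in[OF I(2)[OF that]] .
  then show "?\<gamma> ` I \<subseteq> slit_points M" by (auto simp: in_cdom_lift)
  have fst: "fst (?\<gamma> t) = cinv c (u + t *\<^sub>R a)" if "t \<in> I" for t
    using cinv_lift[OF c, of "u + t *\<^sub>R a" "w + t *\<^sub>R b"] I(2)[OF that] by simp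
  fix d assume d: "d \<in> atlas M"
  let ?S = "cmap c ` (cdom c \<inter> cdom d)" and ?T = "{t \<in> I. ?\<gamma> t \<in> cdom (lift d)}"
  let ?J = "\<lambda>x. frechet_derivative (transition c d) (at x)"
  have T: "t \<in> ?T \<longleftrightarrow> t \<in> I \<and> u + t *\<^sub>R a \<in> ?S" for t
  proof (cases "t \<in> I")
    case True
    then have "u + t *\<^sub>R a \<in> cimg c" using I(2)[of t] cimg_lift[OF c] by simp
    then show ?thesis
      using overlap_image[OF c, of "u + t *\<^sub>R a" d] fst[OF True] in_c[OF True] True
      by (simp add: in_cdom_lift)
  qed simp
  then have "?T = I \<inter> (\<lambda>t. u + t *\<^sub>R a) -` ?S" by blast
  moreover have "open ((\<lambda>t. u + t *\<^sub>R a) -` ?S)"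
    by (rule open_vimage[OF open_overlap[OF c d]]) (intro continuous_intros)
  ultimately show opT: "open ?T" using I(1) by (simp add: open_Int)
  have eq: "(transition c d (u + t *\<^sub>R a), ?J (u + t *\<^sub>R a) (w + t *\<^sub>R b)) = (cmap (lift d) \<circ> ?\<gamma>) t"
    if t: "t \<in> ?T" for t
  proof -
    have "u + t *\<^sub>R a \<in> ?S" "t \<in> I" using t T by blast+
    then show ?thesis
      using transition_lift[OF c d, of "u + t *\<^sub>R a" "w + t *\<^sub>R b"] I(2)[of t]
        overlap_image[OF c, of "u + t *\<^sub>R a" d]
      by (simp add: transition_def[of "lift c"])
  qed
  have "k_smooth_on k ?T (cmap (lift d) \<circ> ?\<gamma>)" for k
  proof (rule k_smooth_on_cong[OF opT eq], assumption, rule k_smooth_on_Pair[OF opT])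
    show "k_smooth_on k ?T (\<lambda>t. transition c d (u + t *\<^sub>R a))"
      by (rule k_smooth_on_compose_line[OF open_overlap[OF c d] _ _ opT])
        (use T transition_smooth[OF c d] in \<open>auto simp: smooth_on_def\<close>)
    show "k_smooth_on k ?T (\<lambda>t. ?J (u + t *\<^sub>R a) (w + t *\<^sub>R b))"
    proof (cases "b = 0")
      case True
      have "k_smooth_on k ?T (\<lambda>t. ?J (u + t *\<^sub>R a) w)"
        by (rule k_smooth_on_compose_line[OF open_overlap[OF c d] _ _ opT, of _ "\<lambda>x. ?J x w"])
          (use T smooth_on_derivative[OF transition_smooth[OF c d], of w] in \<open>auto simp: smooth_on_def\<close>)
      with True show ?thesis by simp
    next
      case False
      with ab have a: "a = 0" by simp
      show ?thesis
      proof (rule k_smooth_on_cong[OF opT _ k_smooth_on_line])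
        fix t assume "t \<in> ?T"
        then have "u \<in> ?S" using T a by simp
        then obtain p where "p \<in> cdom c" "p \<in> cdom d" "u = cmap c p" by blast
        then have "linear (?J u)" using linear_D[OF c d, of p] by simp
        then show "?J u w + t *\<^sub>R ?J u b = ?J (u + t *\<^sub>R a) (w + t *\<^sub>R b)"
          by (simp add: a linear_add linear_scale)
      qed
    qed
  qed
  then show "smooth_on ?T (cmap (lift d) \<circ> ?\<gamma>)" by (simp add: smooth_on_def)
qed

text \<open>The slice condition of an embedded submanifold for a given chart and model subspace.\<close>

definition flat_in :: "('m, 'e) chart \<Rightarrow> 'm set \<Rightarrow> 'e set \<Rightarrow> bool" where
  "flat_in c N W \<longleftrightarrow> c \<in> atlas M \<and> subspace W \<and> cmap c ` (cdom c \<inter> N) = cimg c \<inter> W"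

lemma flat_in_iff:
  assumes "flat_in c N W" "q \<in> cdom c"
  shows "q \<in> N \<longleftrightarrow> cmap c q \<in> W"
proof
  show "cmap c q \<in> W" if "q \<in> N" using assms that unfolding flat_in_def by blast
  assume "cmap c q \<in> W"
  then have "cmap c q \<in> cmap c ` (cdom c \<inter> N)"
    using assms unfolding flat_in_def by (simp add: cimg_def)
  then obtain q' where "cmap c q = cmap c q'" "q' \<in> cdom c" "q' \<in> N" by blast
  then show "q \<in> N"
    using inj_onD[OF inj_chart, of c q q'] assms unfolding flat_in_def by simp
qed

text \<open>A curve in \<open>N\<close> reads in \<open>c\<close> as a curve in \<open>W\<close>, and each direction in \<open>W\<close> is realised by a
  coordinate line.\<close>

lemma tangent_to_flat:
  assumes c: "flat_in c N W" and p: "p \<in> cdom c" "p \<in> N"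
  shows "v \<in> tangent_to M N p \<longleftrightarrow> v \<in> tangent_space M p \<and> v c \<in> W"
proof safe
  have c': "c \<in> atlas M" "subspace W" using c unfolding flat_in_def by auto
  assume v: "v \<in> tangent_to M N p"
  then show "v \<in> tangent_space M p" using tangent_to_subset_tangent_space by blast
  show "v c \<in> W"
    using tangent_to_in_subspace[OF v c'(1) p(1) c'(2)] flat_in_iff[OF c] by blast
next
  have c': "c \<in> atlas M" "subspace W" using c unfolding flat_in_def by auto
  assume v: "v \<in> tangent_space M p" "v c \<in> W"
  have u: "cmap c p \<in> cimg c" using p by (simp add: cimg_def)
  obtain \<epsilon> where \<epsilon>: "\<epsilon> > 0" "\<And>t. t \<in> {-\<epsilon><..<\<epsilon>} \<Longrightarrow> cmap c p + t *\<^sub>R v c \<in> cimg c"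
    using coordinate_line_interval[OF open_cimg[OF c'(1)] u, where a = "v c"] by blast
  let ?\<gamma> = "\<lambda>t. cinv c (cmap c p + t *\<^sub>R v c)"
  have \<gamma>0: "?\<gamma> 0 = p" using cinv_cmap[OF c'(1) p(1)] by simp
  have smooth: "smooth_curve M {-\<epsilon><..<\<epsilon>} ?\<gamma>"
    by (rule smooth_coordinate_line[OF c'(1)]) (use \<epsilon> in auto)
  have "velocity M ?\<gamma> 0 c = v c"
    by (rule velocity_coordinate_line[OF c'(1), of "{-\<epsilon><..<\<epsilon>}"]) (use \<epsilon> in auto)
  moreover have "velocity M ?\<gamma> 0 \<in> tangent_space M p"
    using velocity_in_tangent_space[OF smooth, of 0] \<epsilon>(1) \<gamma>0 by simp
  ultimately have "v = velocity M ?\<gamma> 0"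
    using tangent_vector_eqI[OF v(1) _ c'(1) p(1)] by simp
  moreover have "?\<gamma> t \<in> N" if "t \<in> {-\<epsilon><..<\<epsilon>}" for t
  proof -
    have "cmap c p \<in> W" using flat_in_iff[OF c p(1)] p(2) by simp
    then have "cmap c p + t *\<^sub>R v c \<in> W" using v(2) c'(2) by (simp add: subspace_add subspace_scale)
    then show ?thesis
      using flat_in_iff[OF c cinv_in[OF \<epsilon>(2)[OF that]]] cmap_cinv[OF \<epsilon>(2)[OF that]] by simp
  qed
  ultimately show "v \<in> tangent_to M N p"
    unfolding tangent_to_def using \<epsilon>(1) \<gamma>0 smooth by blast
qed

lemma hat_flat:
  assumes c: "flat_in c N W" and z: "z \<in> cdom (lift c)"
  shows "z \<in> hat M N \<longleftrightarrow> cmap (lift c) z \<in> W \<times> W"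
  using tangent_to_flat[OF c, of "fst z" "snd z"] flat_in_iff[OF c, of "fst z"] slit_pointsD(2)[of z] z
  by (auto simp: hat_def cmap_lift in_cdom_lift)

lemma tangent_to_hat_flat:
  assumes c: "flat_in c N W" and z: "z \<in> cdom (lift c)" and \<xi>: "\<xi> \<in> tangent_to slit (hat M N) z"
  shows "\<xi> (lift c) \<in> W \<times> W"
proof (rule slit.tangent_to_in_subspace[OF \<xi> _ z])
  show "lift c \<in> atlas slit" "subspace (W \<times> W)"
    using c unfolding flat_in_def by (auto intro: subspace_Times)
qed (use hat_flat[OF c] in auto)

text \<open>The coordinate line of \<open>lift c\<close> in direction \<open>(a, b)\<close> stays in \<open>W \<times> W\<close>, which is \<open>hat M N\<close> in
  this chart. Directions in the base or in the fibre suffice, as together they span.\<close>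

lemma tangent_to_hatI:
  assumes c: "flat_in c N W" and z: "z \<in> cdom (lift c)" "z \<in> hat M N"
    and ab: "a \<in> W" "b \<in> W" "a = 0 \<or> b = 0"
  shows "\<exists>\<xi>\<in>tangent_to slit (hat M N) z. \<xi> (lift c) = (a, b)"
proof -
  have c': "c \<in> atlas M" "subspace W" using c unfolding flat_in_def by auto
  obtain u w where u: "cmap (lift c) z = (u, w)" by fastforce
  have uW: "u \<in> W" "w \<in> W" using hat_flat[OF c z(1)] z(2) u by auto
  have uc: "(u, w) \<in> cimg (lift c)" using u z(1) by (auto simp: cimg_def image_iff intro!: bexI[of _ z])
  obtain \<epsilon> where \<epsilon>: "\<epsilon> > 0" "\<And>t. t \<in> {-\<epsilon><..<\<epsilon>} \<Longrightarrow> (u, w) + t *\<^sub>R (a, b) \<in> cimg (lift c)"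
    using coordinate_line_interval[OF slit.open_cimg[OF lift_in_atlas[OF c'(1)]] uc, where a = "(a, b)"]
    by blast
  let ?\<gamma> = "\<lambda>t. cinv (lift c) ((u, w) + t *\<^sub>R (a, b))"
  have \<gamma>0: "?\<gamma> 0 = z" using slit.cinv_cmap[OF lift_in_atlas[OF c'(1)] z(1)] u by simp
  have smooth: "smooth_curve slit {-\<epsilon><..<\<epsilon>} ?\<gamma>"
    by (rule smooth_coordinate_line_slit[OF c'(1) ab(3)]) (use \<epsilon> in auto)
  have vel: "velocity slit ?\<gamma> 0 (lift c) = (a, b)"
    by (rule slit.velocity_coordinate_line[OF lift_in_atlas[OF c'(1)], of "{-\<epsilon><..<\<epsilon>}"]) (use \<epsilon> in auto)
  have "?\<gamma> t \<in> hat M N" if "t \<in> {-\<epsilon><..<\<epsilon>}" for t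
    using hat_flat[OF c slit.cinv_in[OF \<epsilon>(2)[OF that]]] slit.cmap_cinv[OF \<epsilon>(2)[OF that]] uW ab c'(2)
    by (simp add: subspace_add subspace_scale)
  then show ?thesis
    using vel \<epsilon>(1) \<gamma>0 smooth unfolding tangent_to_def by blast
qed

section \<open>The connection of a spray\<close>

lemma conn_coeff_has_derivative:
  assumes \<Gamma>: "spray M \<Gamma>" and c: "c \<in> atlas M" and u: "(x, y) \<in> cimg (lift c)"
  shows "((\<lambda>y. spray_coeff \<Gamma> (lift c) (x, y)) has_derivative conn_coeff \<Gamma> (lift c) (x, y)) (at y)"
proof -
  have "smooth_on (cimg (lift c)) (field_rep \<Gamma> (lift c))"
    using \<Gamma> c unfolding spray_def vector_field_def by simp
  then obtain F where F: "(field_rep \<Gamma> (lift c) has_derivative F) (at (x, y))"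
    using smooth_on_differentiable[OF _ u] unfolding differentiable_def by blast
  have "((\<lambda>y. (x, y)) has_derivative (\<lambda>w. (0, w))) (at y)"
    by (auto intro!: derivative_eq_intros)
  from has_derivative_compose[OF this F]
  have "((\<lambda>y. spray_coeff \<Gamma> (lift c) (x, y)) has_derivative (\<lambda>w. - (1/2) *\<^sub>R snd (F (0, w)))) (at y)"
    unfolding spray_coeff_def by (intro has_derivative_scaleR_right has_derivative_snd)
  then show ?thesis
    unfolding conn_coeff_def using differentiableI frechet_derivative_works by fastforce
qed

lemma linear_conn_coeff:
  assumes "spray M \<Gamma>" "c \<in> atlas M" "u \<in> cimg (lift c)"
  shows "linear (conn_coeff \<Gamma> (lift c) u)"
  using has_derivative_linear[OF conn_coeff_has_derivative[of \<Gamma> c "fst u" "snd u"]] assms by simp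

text \<open>Total geodesy says that the coefficients of the spray take values in \<open>W\<close> along
  \<open>W \<times> (W - {0})\<close>; differentiating them in the fibre direction, so do the connection
  coefficients.\<close>

lemma conn_coeff_totally_geodesic:
  assumes \<Gamma>: "spray M \<Gamma>" and N: "totally_geodesic M \<Gamma> k N" and c: "flat_in c N W"
    and z: "z \<in> cdom (lift c)" "z \<in> hat M N" and b: "b \<in> W"
  shows "conn_coeff \<Gamma> (lift c) (cmap (lift c) z) b \<in> W"
proof -
  have c': "c \<in> atlas M" "subspace W" using c unfolding flat_in_def by auto
  obtain x y where u: "cmap (lift c) z = (x, y)" by fastforce
  have uc: "(x, y) \<in> cimg (lift c)" using u z(1) by (auto simp: cimg_def image_iff intro!: bexI[of _ z])
  have xy: "x \<in> W" "y \<in> W" using hat_flat[OF c z(1)] z(2) u by auto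
  have y0: "y \<noteq> 0" using uc cimg_lift[OF c'(1)] by simp
  obtain \<epsilon> where \<epsilon>: "\<epsilon> > 0" "\<And>t. t \<in> {-\<epsilon><..<\<epsilon>} \<Longrightarrow> y + t *\<^sub>R b \<in> - {0}"
    using coordinate_line_interval[of "- {0}" y b] y0 by auto
  have in_W: "spray_coeff \<Gamma> (lift c) (x, y + t *\<^sub>R b) \<in> W" if t: "t \<in> {-\<epsilon><..<\<epsilon>}" for t
  proof -
    let ?z = "cinv (lift c) (x, y + t *\<^sub>R b)"
    have i: "(x, y + t *\<^sub>R b) \<in> cimg (lift c)"
      using uc \<epsilon>(2)[OF t] cimg_lift[OF c'(1)] by simp
    have "?z \<in> hat M N"
      using hat_flat[OF c slit.cinv_in[OF i]] slit.cmap_cinv[OF i] xy b c'(2)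
      by (simp add: subspace_add subspace_scale)
    then have "\<Gamma> ?z \<in> tangent_to slit (hat M N) ?z" using N unfolding totally_geodesic_def by blast
    from tangent_to_hat_flat[OF c slit.cinv_in[OF i] this]
    have "snd (\<Gamma> ?z (lift c)) \<in> W" by auto
    then show ?thesis
      using subspace_scale[OF c'(2), of "snd (\<Gamma> ?z (lift c))" "- (1/2)"]
      by (simp add: spray_coeff_def field_rep_def)
  qed
  let ?F = "conn_coeff \<Gamma> (lift c) (x, y)"
  have "((\<lambda>t. y + t *\<^sub>R b) has_derivative (\<lambda>t. t *\<^sub>R b)) (at 0)"
    by (auto intro!: derivative_eq_intros)
  from has_derivative_compose[OF this, of "\<lambda>y. spray_coeff \<Gamma> (lift c) (x, y)" ?F]
  have "((\<lambda>t. spray_coeff \<Gamma> (lift c) (x, y + t *\<^sub>R b)) has_vector_derivative ?F b) (at 0)"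
    using conn_coeff_has_derivative[OF \<Gamma> c'(1) uc] linear_scale[OF linear_conn_coeff[OF \<Gamma> c'(1) uc]]
    by (simp add: has_vector_derivative_def)
  from vector_derivative_in_subspace[OF c'(2) this, of "{-\<epsilon><..<\<epsilon>}"] in_W \<epsilon>(1)
  show ?thesis by (simp add: u)
qed

end

section \<open>Constancy of sign\<close>

lemma nonzero_on_segment_same_sign:
  fixes f :: "'a::real_normed_vector \<Rightarrow> real"
  assumes "continuous_on (closed_segment a b) f" "\<And>x. x \<in> closed_segment a b \<Longrightarrow> f x \<noteq> 0"
  shows "0 < f a \<longleftrightarrow> 0 < f b"
proof -
  let ?F = "f ` closed_segment a b"
  have "connected ?F" using assms(1) by (rule connected_continuous_image) simp
  then have ivl: "0 \<in> ?F" if "x \<in> ?F" "y \<in> ?F" "x \<le> 0" "0 \<le> y" for x y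
    using that connectedD_interval by blast
  have "f a \<in> ?F" "f b \<in> ?F" "0 \<notin> ?F" using assms(2) by auto
  then show ?thesis using ivl[of "f a" "f b"] ivl[of "f b" "f a"] by linarith
qed

lemma exists_not_in_span2:
  fixes x y :: "'a::euclidean_space"
  assumes "DIM('a) \<ge> 3"
  obtains u :: 'a where "u \<notin> span {x, y}"
proof -
  have "dim (span {x, y}) \<le> card {x, y}" by (simp add: dim_le_card')
  also have "\<dots> \<le> 2" by (simp add: card_insert_if)
  finally have "span {x, y} \<noteq> UNIV" using assms by (metis dim_UNIV not_less_eq_eq numeral_2_eq_2 numeral_3_eq_3 order_trans)
  then show ?thesis using that by blast
qed

text \<open>In dimension at least three the set of linearly independent pairs is connected by chains of
  segments in which one vector of the pair stays fixed: a third vector outside the plane of two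
  given ones provides the detour.\<close>

lemma constant_sign_on_independent_pairs:
  fixes Q :: "'a::euclidean_space \<Rightarrow> 'a \<Rightarrow> real"
  assumes dim: "DIM('a) \<ge> 3"
    and nz: "\<And>y v. y \<noteq> 0 \<Longrightarrow> v \<notin> span {y} \<Longrightarrow> Q y v \<noteq> 0"
    and cont1: "\<And>v. continuous_on (- {0}) (\<lambda>y. Q y v)"
    and cont2: "\<And>y. y \<noteq> 0 \<Longrightarrow> continuous_on UNIV (Q y)"
  shows "(\<forall>y v. y \<noteq> 0 \<longrightarrow> v \<notin> span {y} \<longrightarrow> Q y v > 0) \<or>
         (\<forall>y v. y \<noteq> 0 \<longrightarrow> v \<notin> span {y} \<longrightarrow> Q y v < 0)"
proof -
  have segment: "x \<notin> span {y}" 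
    if v: "v \<notin> span {y}" and w: "w \<notin> span {y, v}" and x: "x \<in> closed_segment v w" for x y v w :: 'a
  proof
    assume xy: "x \<in> span {y}"
    obtain t where t: "x = (1 - t) *\<^sub>R v + t *\<^sub>R w" using x unfolding closed_segment_def by blast
    show False
    proof (cases "t = 0")
      case True
      with t xy v show False by simp
    next
      case False
      have "x - (1 - t) *\<^sub>R v \<in> span {y, v}"
        using xy span_mono[of "{y}" "{y, v}"] by (intro span_diff span_scale) (auto intro: span_base)
      then have "t *\<^sub>R w \<in> span {y, v}" by (simp add: t)
      then have "(1 / t) *\<^sub>R (t *\<^sub>R w) \<in> span {y, v}" by (rule span_scale)
      moreover have "(1 / t) *\<^sub>R (t *\<^sub>R w) = w" using False by simp
      ultimately show False using w by metis
    qed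
  qed
  have fixed_y1: "0 < Q y v \<longleftrightarrow> 0 < Q y w" if "y \<noteq> 0" "v \<notin> span {y}" "w \<notin> span {y, v}" for y v w
    by (rule nonzero_on_segment_same_sign)
      (use that segment nz continuous_on_subset[OF cont2[OF that(1)]] in auto)
  have fixed_y: "0 < Q y v \<longleftrightarrow> 0 < Q y w" if y: "y \<noteq> 0" and v: "v \<notin> span {y}" and w: "w \<notin> span {y}" for y v w
  proof (cases "w \<in> span {y, v}")
    case True
    obtain u where u: "u \<notin> span {y, v}" using exists_not_in_span2[OF dim] .
    have "span {y, w} \<subseteq> span {y, v}"
      using True by (intro span_minimal) (auto intro: span_base)
    with u show ?thesis using fixed_y1[OF y v u] fixed_y1[OF y w, of u] by blast
  qed (rule fixed_y1[OF y v])
  have change_y: "0 < Q y v \<longleftrightarrow> 0 < Q y' v'"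
    if y: "y \<noteq> 0" "y' \<notin> span {y}" and v: "v \<notin> span {y}" "v' \<notin> span {y'}" for y y' v v'
  proof -
    have y'0: "y' \<noteq> 0" using y(2) span_zero by blast
    obtain u where u: "u \<notin> span {y, y'}" using exists_not_in_span2[OF dim] .
    have sub: "span {x} \<subseteq> span {y, y'}" if x: "x \<in> closed_segment y y'" for x
    proof -
      obtain t where "x = (1 - t) *\<^sub>R y + t *\<^sub>R y'" using x unfolding closed_segment_def by blast
      then have "x \<in> span {y, y'}" by (auto intro!: span_add span_scale intro: span_base)
      then show ?thesis by (intro span_minimal) auto
    qed
    have "x \<noteq> 0" if "x \<in> closed_segment y y'" for x
      using segment[of y 0 y' x] that y by simp
    then have "Q x u \<noteq> 0" "x \<in> - {0}" if "x \<in> closed_segment y y'" for x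
      using that u sub[OF that] nz[of x u] by auto
    then have "0 < Q y u \<longleftrightarrow> 0 < Q y' u"
      by (intro nonzero_on_segment_same_sign[where f = "\<lambda>x. Q x u"] continuous_on_subset[OF cont1]) auto
    moreover have "u \<notin> span {y}" "u \<notin> span {y'}" using u sub by auto
    ultimately show ?thesis using fixed_y[OF y(1) v(1)] fixed_y[OF y'0 v(2)] by blast
  qed
  have all: "0 < Q y v \<longleftrightarrow> 0 < Q y' v'"
    if "y \<noteq> 0" "y' \<noteq> 0" "v \<notin> span {y}" "v' \<notin> span {y'}" for y y' v v'
  proof -
    obtain u where u: "u \<notin> span {y, y'}" using exists_not_in_span2[OF dim] .
    then have u': "u \<notin> span {y}" "u \<notin> span {y'}"
      using span_mono[of "{y}" "{y, y'}"] span_mono[of "{y'}" "{y, y'}"] by auto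
    \<comment> \<open>some vector independent of \<open>u\<close>, through which both chains pass\<close>
    obtain w where "w \<notin> span {u, u}" using exists_not_in_span2[OF dim] .
    then have "w \<notin> span {u}" by simp
    then show ?thesis
      using change_y[OF that(1) u'(1) that(3)] change_y[OF that(2) u'(2) that(4)] by blast
  qed
  show ?thesis
  proof (cases "\<exists>y v. y \<noteq> 0 \<and> v \<notin> span {y} \<and> Q y v > 0")
    case True
    then show ?thesis using all by blast
  next
    case False
    then show ?thesis using nz by (metis linorder_neqE_linordered_idom)
  qed
qed


section \<open>The components of the two-form\<close>

lemma component_sum:
  "(\<Sum>i\<in>UNIV. \<Sum>j\<in>UNIV. A $ i $ j * v $ i * w $ j) = v \<bullet> (A *v w)" for A :: "real^'n^'m"
  by (simp add: inner_vec_def matrix_vector_mult_def sum_distrib_left ac_simps)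

lemma positive_quasi_definite_iff:
  "positive_quasi_definite M g \<longleftrightarrow>
    (\<forall>c\<in>atlas M. \<forall>(x, y)\<in>cimg (lift_chart M c). \<forall>v. v \<bullet> (g c (x, y) *v v) \<ge> 0 \<and>
      (v \<bullet> (g c (x, y) *v v) = 0 \<longrightarrow> (\<exists>s. v = s *\<^sub>R y)))"
  unfolding positive_quasi_definite_def component_sum ..

locale spray_form = smooth_mfd M for M :: "('m, real^'n::finite) mfd" +
  fixes \<Gamma> :: "(('m, real^'n) tm, (real^'n) \<times> (real^'n)) vfield"
    and \<omega> :: "(('m, real^'n) tm, (real^'n) \<times> (real^'n)) form2"
    and h :: "('m, 'n) components"
  assumes spray: "spray M \<Gamma>"
    and admissible: "admissible M \<Gamma> \<omega>"
    and components: "has_components M \<Gamma> \<omega> h"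
begin

lemma form_rep_components:
  assumes "c \<in> atlas M" "u \<in> cimg (lift c)"
  shows "form_rep slit \<omega> (lift c) u a b =
    fst a \<bullet> (h c u *v phi \<Gamma> (lift c) u b) - fst b \<bullet> (h c u *v phi \<Gamma> (lift c) u a)"
  using components assms unfolding has_components_def
  by (cases a, cases b) (simp add: right_diff_distrib sum_subtractf mult.assoc[symmetric] component_sum)

lemma phi_vertical:
  assumes "c \<in> atlas M" "u \<in> cimg (lift c)"
  shows "phi \<Gamma> (lift c) u (0, w) = w"
  using linear_0[OF linear_conn_coeff[OF spray assms]] by (simp add: phi_def)

lemma cmap_lift_in_cimg: "z \<in> cdom (lift c) \<Longrightarrow> cmap (lift c) z \<in> cimg (lift c)"
  by (simp add: cimg_def)

lemma form_components:
  assumes c: "c \<in> atlas M" and z: "z \<in> cdom (lift c)"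
    and \<xi>: "\<xi> \<in> tangent_space slit z" and \<eta>: "\<eta> \<in> tangent_space slit z"
  shows "\<omega> z \<xi> \<eta> =
    fst (\<xi> (lift c)) \<bullet> (h c (cmap (lift c) z) *v phi \<Gamma> (lift c) (cmap (lift c) z) (\<eta> (lift c))) -
    fst (\<eta> (lift c)) \<bullet> (h c (cmap (lift c) z) *v phi \<Gamma> (lift c) (cmap (lift c) z) (\<xi> (lift c)))"
proof -
  have "form_rep slit \<omega> (lift c) (cmap (lift c) z) (\<xi> (lift c)) (\<eta> (lift c)) = \<omega> z \<xi> \<eta>"
    using slit.tvec_of_coord[OF \<xi> lift_in_atlas[OF c] z] slit.tvec_of_coord[OF \<eta> lift_in_atlas[OF c] z]
    by (simp only: form_rep_def slit.cinv_cmap[OF lift_in_atlas[OF c] z])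
  then show ?thesis using form_rep_components[OF c cmap_lift_in_cimg[OF z]] by metis
qed

text \<open>Contracting with a vertical vector leaves only the base component of the other argument.
  This identifies \<open>h\<close> intrinsically and frees most computations from the connection.\<close>

lemma form_vertical:
  assumes c: "c \<in> atlas M" and z: "z \<in> cdom (lift c)"
    and \<xi>: "\<xi> \<in> tangent_space slit z" and \<eta>: "\<eta> \<in> tangent_space slit z" "\<eta> (lift c) = (0, w)"
  shows "\<omega> z \<xi> \<eta> = fst (\<xi> (lift c)) \<bullet> (h c (cmap (lift c) z) *v w)"
  using form_components[OF c z \<xi> \<eta>(1)] phi_vertical[OF c cmap_lift_in_cimg[OF z]] \<eta>(2) by simp

lemma continuous_h:
  assumes c: "c \<in> atlas M"
  shows "continuous_on (cimg (lift c)) (\<lambda>u. v \<bullet> (h c u *v w))"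
proof -
  have "smooth_on (cimg (lift c)) (\<lambda>u. form_rep slit \<omega> (lift c) u (v, 0) (0, w))"
    using admissible lift_in_atlas[OF c] unfolding admissible_def two_form_def by blast
  then have "continuous_on (cimg (lift c)) (\<lambda>u. form_rep slit \<omega> (lift c) u (v, 0) (0, w))"
    by (rule smooth_on_continuous)
  then show ?thesis
    by (rule continuous_on_eq) (simp add: form_rep_components[OF c] phi_vertical[OF c])
qed

text \<open>Both sides are the value of \<open>\<omega>\<close> on one and the same pair of tangent vectors: one above \<open>v\<close>
  and the vertical lift of \<open>w\<close>, which the block-triangular transition derivative respects.\<close>

lemma h_change_chart:
  assumes z: "z \<in> slit_points M" and c: "c \<in> atlas M" "fst z \<in> cdom c" and d: "d \<in> atlas M" "fst z \<in> cdom d"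
    and v: "v \<in> tangent_space M (fst z)" and w: "w \<in> tangent_space M (fst z)"
  shows "v d \<bullet> (h d (cmap (lift d) z) *v w d) = v c \<bullet> (h c (cmap (lift c) z) *v w c)"
proof -
  have zc: "z \<in> cdom (lift c)" "z \<in> cdom (lift d)" using z c d by (simp_all add: in_cdom_lift)
  define \<xi> where "\<xi> = tvec_of slit (lift c) z (v c, 0)"
  define \<eta> where "\<eta> = tvec_of slit (lift c) z (0, w c)"
  have T: "\<xi> \<in> tangent_space slit z" "\<eta> \<in> tangent_space slit z"
    unfolding \<xi>_def \<eta>_def by (rule slit.tvec_of_in_tangent_space[OF lift_in_atlas[OF c(1)] zc(1)])+
  have xc: "\<xi> (lift c) = (v c, 0)" "\<eta> (lift c) = (0, w c)"
    unfolding \<xi>_def \<eta>_def by (rule slit.tvec_of_self[OF lift_in_atlas[OF c(1)] zc(1)])+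
  have "fst (\<xi> (lift d)) = v d"
    using slit_tangent_fst[OF T(1) z c d] tangent_space_D[OF v c d] xc by simp
  moreover have "\<eta> (lift d) = (0, w d)"
    using slit_tangent_vertical[OF T(2) z c d xc(2)] tangent_space_D[OF w c d] by simp
  ultimately have "\<omega> z \<xi> \<eta> = v d \<bullet> (h d (cmap (lift d) z) *v w d)"
    using form_vertical[OF d(1) zc(2) T] by simp
  then show ?thesis using form_vertical[OF c(1) zc(1) T xc(2)] xc by simp
qed

text \<open>\<open>h\<close> annihilates the direction \<open>y\<close> from the left because the spray projects to \<open>y\<close>, and from
  the right because the Liouville field is the vertical vector \<open>y\<close>; both fields are characteristic.\<close>

lemma h_radical:
  assumes c: "c \<in> atlas M" and u: "(x, y) \<in> cimg (lift c)"
  shows "y \<bullet> (h c (x, y) *v w) = 0" and "w \<bullet> (h c (x, y) *v y) = 0"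
proof -
  let ?z = "cinv (lift c) (x, y)"
  have z: "?z \<in> cdom (lift c)" "cmap (lift c) ?z = (x, y)"
    using slit.cinv_in[OF u] slit.cmap_cinv[OF u] by auto
  then have zs: "?z \<in> slit_points M" by (simp add: in_cdom_lift)
  have ch: "spray_distribution M \<Gamma> ?z \<subseteq> characteristic slit \<omega> ?z"
    using admissible zs unfolding admissible_def by blast
  have "(\<lambda>C. 0 *\<^sub>R liouville M ?z C + 1 *\<^sub>R \<Gamma> ?z C) \<in> spray_distribution M \<Gamma> ?z"
    unfolding spray_distribution_def by blast
  then have G: "\<Gamma> ?z \<in> characteristic slit \<omega> ?z" using ch by auto
  have "(\<lambda>C. 1 *\<^sub>R liouville M ?z C + 0 *\<^sub>R \<Gamma> ?z C) \<in> spray_distribution M \<Gamma> ?z"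
    unfolding spray_distribution_def by blast
  then have L: "liouville M ?z \<in> characteristic slit \<omega> ?z" using ch by auto
  have GT: "\<Gamma> ?z \<in> tangent_space slit ?z" "liouville M ?z \<in> tangent_space slit ?z"
    using G L unfolding characteristic_def by auto
  define \<xi> where "\<xi> = tvec_of slit (lift c) ?z (w, 0)"
  define \<eta> where "\<eta> = tvec_of slit (lift c) ?z (0, w)"
  have T: "\<xi> \<in> tangent_space slit ?z" "\<eta> \<in> tangent_space slit ?z"
    unfolding \<xi>_def \<eta>_def by (rule slit.tvec_of_in_tangent_space[OF lift_in_atlas[OF c] z(1)])+
  have xc: "\<xi> (lift c) = (w, 0)" "\<eta> (lift c) = (0, w)"
    unfolding \<xi>_def \<eta>_def by (rule slit.tvec_of_self[OF lift_in_atlas[OF c] z(1)])+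
  have "fst (field_rep \<Gamma> (lift c) (x, y)) = y"
    using spray u lift_in_atlas[OF c] unfolding spray_def by fastforce
  then have "fst (\<Gamma> ?z (lift c)) = y" by (simp add: field_rep_def)
  moreover have "\<omega> ?z (\<Gamma> ?z) \<eta> = 0" using G T unfolding characteristic_def by blast
  ultimately show "y \<bullet> (h c (x, y) *v w) = 0"
    using form_vertical[OF c z(1) GT(1) T(2) xc(2)] z(2) by simp
  have Lc: "liouville M ?z (lift c) = (0, y)"
    using z lift_in_atlas[OF c] by (simp add: liouville_def)
  have "\<omega> ?z (liouville M ?z) \<xi> = 0" using L T unfolding characteristic_def by blast
  then show "w \<bullet> (h c (x, y) *v y) = 0"
    using form_components[OF c z(1) GT(2) T(1)] phi_vertical[OF c u] z(2) Lc xc by simp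
qed

lemma totally_geodesic_flat:
  assumes "totally_geodesic M \<Gamma> 2 N" "p \<in> N"
  obtains c W where "flat_in c N W" "p \<in> cdom c" "dim W = 2"
  using assms unfolding totally_geodesic_def proper_embedded_submanifold_def
    embedded_submanifold_def flat_in_def by blast

text \<open>For \<open>v\<close> tangent to \<open>N\<close>, evaluating \<open>\<omega>\<close> on a tangent vector of \<open>hat M N\<close> above \<open>v\<close> and on the
  vertical vector \<open>v\<close> gives \<open>h(v, v)\<close>.\<close>

lemma form_nonzero_on_hat:
  assumes pos: "positive_quasi_definite M h"
    and N: "totally_geodesic M \<Gamma> 2 N" and z: "z \<in> hat M N"
  shows "\<exists>\<xi>\<in>tangent_to slit (hat M N) z. \<exists>\<eta>\<in>tangent_to slit (hat M N) z. \<omega> z \<xi> \<eta> \<noteq> 0"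
proof -
  have "fst z \<in> N" "z \<in> slit_points M" using z by (auto simp: hat_def)
  then obtain c W where c: "flat_in c N W" "fst z \<in> cdom c" "dim W = 2"
    using totally_geodesic_flat[OF N] by metis
  then have zc: "z \<in> cdom (lift c)" using \<open>z \<in> slit_points M\<close> by (simp add: in_cdom_lift)
  have c': "c \<in> atlas M" "subspace W" using c unfolding flat_in_def by auto
  obtain x y where u: "cmap (lift c) z = (x, y)" by fastforce
  have yW: "y \<in> W" using hat_flat[OF c(1) zc] z u by simp
  have "dim (span {y}) \<le> 1" using dim_le_card'[of "{y}"] by simp
  then have "\<not> W \<subseteq> span {y}" using c(3) dim_subset[of W "span {y}"] by linarith
  then obtain v where v: "v \<in> W" "v \<notin> span {y}" by blast
  obtain \<xi> where \<xi>: "\<xi> \<in> tangent_to slit (hat M N) z" "\<xi> (lift c) = (v, 0)"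
    using tangent_to_hatI[OF c(1) zc z v(1) subspace_0[OF c'(2)]] by blast
  obtain \<eta> where \<eta>: "\<eta> \<in> tangent_to slit (hat M N) z" "\<eta> (lift c) = (0, v)"
    using tangent_to_hatI[OF c(1) zc z subspace_0[OF c'(2)] v(1)] by blast
  have "\<xi> \<in> tangent_space slit z" "\<eta> \<in> tangent_space slit z"
    using \<xi>(1) \<eta>(1) slit.tangent_to_subset_tangent_space by blast+
  from form_vertical[OF c'(1) zc this \<eta>(2)]
  have "\<omega> z \<xi> \<eta> = v \<bullet> (h c (x, y) *v v)" using \<xi>(2) u by simp
  moreover have "v \<bullet> (h c (x, y) *v v) \<noteq> 0"
    using pos c'(1) cmap_lift_in_cimg[OF zc] v(2) unfolding positive_quasi_definite_iff u span_singleton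
    by blast
  ultimately show ?thesis using \<xi>(1) \<eta>(1) by metis
qed

text \<open>Conversely, with \<open>W\<close> spanned by \<open>y\<close> and \<open>v\<close>, all base components of tangent vectors of
  \<open>hat M N\<close> and, by total geodesy, all their values under \<open>phi\<close> lie in \<open>W\<close>. Since \<open>h\<close>
  annihilates \<open>y\<close>, the form is there a multiple of \<open>h(v, v)\<close>.\<close>

lemma h_nonzero_of_form_nonzero:
  assumes N: "totally_geodesic M \<Gamma> 2 N" and c: "flat_in c N W" "dim W = 2"
    and z: "z \<in> cdom (lift c)" "z \<in> hat M N" "cmap (lift c) z = (x, y)"
    and nz: "\<xi> \<in> tangent_to slit (hat M N) z" "\<eta> \<in> tangent_to slit (hat M N) z" "\<omega> z \<xi> \<eta> \<noteq> 0"
    and v: "v \<in> W" "v \<notin> span {y}"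
  shows "v \<bullet> (h c (x, y) *v v) \<noteq> 0"
proof
  assume 0: "v \<bullet> (h c (x, y) *v v) = 0"
  have c': "c \<in> atlas M" "subspace W" using c unfolding flat_in_def by auto
  have u: "(x, y) \<in> cimg (lift c)" using cmap_lift_in_cimg[OF z(1)] z(3) by simp
  have yW: "y \<in> W" using hat_flat[OF c(1) z(1)] z by simp
  have y0: "y \<noteq> 0" using u cimg_lift[OF c'(1)] by simp
  have "independent {v, y}" using v(2) y0 by (simp add: independent_insert)
  moreover have "v \<noteq> y" using v(2) span_base by blast
  ultimately have "W \<subseteq> span {v, y}"
    using card_ge_dim_independent[of "{v, y}" W] v(1) yW c(2) by simp
  then have decomp: "\<exists>s t. a = s *\<^sub>R v + t *\<^sub>R y" if a: "a \<in> W" for a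
  proof -
    have "a \<in> span (insert v {y})" using \<open>W \<subseteq> span {v, y}\<close> a by blast
    then obtain s where "a - s *\<^sub>R v \<in> span {y}" unfolding span_breakdown_eq by blast
    then obtain t where "a - s *\<^sub>R v = t *\<^sub>R y" unfolding span_singleton by blast
    then have "a = s *\<^sub>R v + t *\<^sub>R y" by (simp add: algebra_simps)
    then show ?thesis by blast
  qed
  have hW: "a \<bullet> (h c (x, y) *v b) = 0" if ab: "a \<in> W" "b \<in> W" for a b
  proof -
    obtain s t s' t' where "a = s *\<^sub>R v + t *\<^sub>R y" "b = s' *\<^sub>R v + t' *\<^sub>R y"
      using decomp[OF ab(1)] decomp[OF ab(2)] by blast
    then show ?thesis
      using 0 h_radical[OF c'(1) u]
      by (simp add: inner_left_distrib inner_right_distrib matrix_vector_right_distrib matrix_vector_mult_scaleR)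
  qed
  have in_W: "fst (\<zeta> (lift c)) \<in> W" "phi \<Gamma> (lift c) (x, y) (\<zeta> (lift c)) \<in> W"
    if "\<zeta> \<in> tangent_to slit (hat M N) z" for \<zeta>
  proof -
    have \<zeta>: "fst (\<zeta> (lift c)) \<in> W" "snd (\<zeta> (lift c)) \<in> W"
      using tangent_to_hat_flat[OF c(1) z(1) that] by (simp_all add: mem_Times_iff)
    then show "fst (\<zeta> (lift c)) \<in> W" by simp
    show "phi \<Gamma> (lift c) (x, y) (\<zeta> (lift c)) \<in> W"
      using conn_coeff_totally_geodesic[OF spray N c(1) z(1,2) \<zeta>(1)] \<zeta>(2) z(3) c'(2)
      by (simp add: phi_def subspace_add)
  qed
  have "\<omega> z \<xi> \<eta> = 0"
    using form_components[OF c'(1) z(1), of \<xi> \<eta>] nz(1,2) slit.tangent_to_subset_tangent_space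
      hW in_W z(3) by (simp add: subset_iff)
  with nz(3) show False by simp
qed

text \<open>Linear dependence of tangent vectors can be tested in any chart, since a tangent vector is
  determined by one coordinate vector.\<close>

lemma tangent_space_dependent:
  assumes v: "v \<in> tangent_space M p" and y: "y \<in> tangent_space M p"
    and c: "c \<in> atlas M" "p \<in> cdom c" and d: "d \<in> atlas M" "p \<in> cdom d"
    and dep: "v c \<in> span {y c}"
  shows "v d \<in> span {y d}"
proof -
  obtain s where s: "v c = s *\<^sub>R y c" using dep unfolding span_singleton by blast
  have "(\<lambda>c. s *\<^sub>R y c + 0 *\<^sub>R y c) \<in> tangent_space M p" by (rule tangent_space_combination[OF y y])
  then have "v = (\<lambda>c. s *\<^sub>R y c + 0 *\<^sub>R y c)"
    by (rule tangent_vector_eqI[OF v _ c]) (simp add: s)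
  then have "v d = s *\<^sub>R y d" by (metis add.right_neutral scaleR_zero_left)
  then show ?thesis by (simp add: span_scale span_base)
qed

lemma plane_tangent_subspace:
  assumes y: "y \<in> tangent_space M p" and v: "v \<in> tangent_space M p"
    and c: "c \<in> atlas M" "p \<in> cdom c" and ind: "y c \<noteq> 0" "v c \<notin> span {y c}"
  shows "tangent_subspace M p 2 {(\<lambda>c. a *\<^sub>R y c + b *\<^sub>R v c) | a b. True}"
  unfolding tangent_subspace_def
proof (intro conjI ballI impI)
  show "{(\<lambda>c. a *\<^sub>R y c + b *\<^sub>R v c) | a b. True} \<subseteq> tangent_space M p"
    using tangent_space_combination[OF y v] by blast
  fix d assume d: "d \<in> atlas M" "p \<in> cdom d"
  have eq: "(\<lambda>w. w d) ` {(\<lambda>c. a *\<^sub>R y c + b *\<^sub>R v c) | a b. True} = span {v d, y d}"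
  proof (intro set_eqI iffI)
    fix x assume "x \<in> (\<lambda>w. w d) ` {(\<lambda>c. a *\<^sub>R y c + b *\<^sub>R v c) | a b. True}"
    then show "x \<in> span {v d, y d}" by (auto intro!: span_add span_scale intro: span_base)
  next
    fix x assume "x \<in> span {v d, y d}"
    then obtain b where "x - b *\<^sub>R v d \<in> span {y d}" unfolding span_breakdown_eq by blast
    then obtain a where "x - b *\<^sub>R v d = a *\<^sub>R y d" unfolding span_singleton by blast
    then have "x = a *\<^sub>R y d + b *\<^sub>R v d" by (simp add: algebra_simps)
    then show "x \<in> (\<lambda>w. w d) ` {(\<lambda>c. a *\<^sub>R y c + b *\<^sub>R v c) | a b. True}"
      by (intro image_eqI[where x = "\<lambda>c. a *\<^sub>R y c + b *\<^sub>R v c"]) auto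
  qed
  have vd: "v d \<notin> span {y d}" using tangent_space_dependent[OF v y d c] ind(2) by blast
  have yd: "y d \<noteq> 0"
  proof
    assume "y d = 0"
    then have "y d \<in> span {(\<lambda>_. 0) d}" by simp
    from tangent_space_dependent[OF y zero_in_tangent_space d c this] ind(1) show False by simp
  qed
  have "v d \<noteq> y d" using vd span_base[of "y d" "{y d}"] by auto
  then have "dim (span {v d, y d}) = 2"
    using dim_eq_card_independent[of "{v d, y d}"] vd yd by (simp add: independent_insert)
  then show "dim ((\<lambda>w. w d) ` {(\<lambda>c. a *\<^sub>R y c + b *\<^sub>R v c) | a b. True}) = 2"
    "subspace ((\<lambda>w. w d) ` {(\<lambda>c. a *\<^sub>R y c + b *\<^sub>R v c) | a b. True})"
    by (simp_all only: eq subspace_span)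
qed

end

locale spray_form_planes = spray_form M \<Gamma> \<omega> h
  for M :: "('m, real^'n::finite) mfd" and \<Gamma> \<omega> h +
  assumes planes: "\<forall>x\<in>points M. \<forall>W. tangent_subspace M x 2 W \<longrightarrow>
      (\<exists>N. totally_geodesic M \<Gamma> 2 N \<and> x \<in> N \<and> tangent_to M N x = W)"
    and nonvanishing: "\<And>N z. totally_geodesic M \<Gamma> 2 N \<Longrightarrow> z \<in> hat M N \<Longrightarrow>
      \<exists>\<xi>\<in>tangent_to slit (hat M N) z. \<exists>\<eta>\<in>tangent_to slit (hat M N) z. \<omega> z \<xi> \<eta> \<noteq> 0"
    and dim3: "CARD('n) \<ge> 3"
begin

text \<open>The plane of \<open>y\<close> and \<open>v\<close> is tangent to some totally geodesic surface; there \<open>h(v, v) \<noteq> 0\<close> is known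
  in a flattening chart, from which it is carried to the chart \<open>c\<close>.\<close>

lemma h_nonzero:
  assumes c: "c \<in> atlas M" and u: "(x, y) \<in> cimg (lift c)" and v: "v \<notin> span {y}"
  shows "v \<bullet> (h c (x, y) *v v) \<noteq> 0"
proof -
  have xy: "x \<in> cimg c" "y \<noteq> 0" using u cimg_lift[OF c] by auto
  define p where "p = cinv c x"
  have p: "p \<in> cdom c" "cmap c p = x" using cinv_in[OF xy(1)] cmap_cinv[OF xy(1)] by (auto simp: p_def)
  define Y where "Y = tvec_of M c p y"
  define V where "V = tvec_of M c p v"
  have T: "Y \<in> tangent_space M p" "V \<in> tangent_space M p"
    unfolding Y_def V_def by (rule tvec_of_in_tangent_space[OF c p(1)])+
  have Yc: "Y c = y" "V c = v"
    unfolding Y_def V_def by (rule tvec_of_self[OF c p(1)])+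
  have pM: "p \<in> points M" using cdom_subset[OF c] p(1) by blast
  let ?W = "{(\<lambda>c. a *\<^sub>R Y c + b *\<^sub>R V c) | a b. True}"
  have sub: "tangent_subspace M p 2 ?W"
    by (rule plane_tangent_subspace[OF T c p(1)]) (use Yc xy v in auto)
  obtain N where N: "totally_geodesic M \<Gamma> 2 N" "p \<in> N" "tangent_to M N p = ?W"
    using planes[rule_format, OF pM sub] by (elim exE conjE)
  have "(\<lambda>c. 1 *\<^sub>R Y c + 0 *\<^sub>R V c) \<in> ?W" "(\<lambda>c. 0 *\<^sub>R Y c + 1 *\<^sub>R V c) \<in> ?W" by blast+
  then have W: "Y \<in> tangent_to M N p" "V \<in> tangent_to M N p" using N(3) by simp_all
  have z: "(p, Y) \<in> slit_points M"
    unfolding Y_def by (rule tvec_of_slit_point[OF c p(1) xy(2)])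
  then have zN: "(p, Y) \<in> hat M N" using W N(2) by (simp add: hat_def)
  obtain d W0 where d: "flat_in d N W0" "p \<in> cdom d" "dim W0 = 2"
    using totally_geodesic_flat[OF N(1,2)] .
  have d': "d \<in> atlas M" using d unfolding flat_in_def by auto
  obtain \<xi> \<eta> where nz: "\<xi> \<in> tangent_to slit (hat M N) (p, Y)" "\<eta> \<in> tangent_to slit (hat M N) (p, Y)"
      "\<omega> (p, Y) \<xi> \<eta> \<noteq> 0"
    using nonvanishing[OF N(1) zN] by blast
  have "V d \<bullet> (h d (cmap d p, Y d) *v V d) \<noteq> 0"
  proof (rule h_nonzero_of_form_nonzero[OF N(1) d(1,3) _ zN _ nz])
    show "(p, Y) \<in> cdom (lift d)" using z d(2) by (simp add: in_cdom_lift)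
    show "cmap (lift d) (p, Y) = (cmap d p, Y d)" by (simp add: cmap_lift)
    show "V d \<in> W0" using tangent_to_flat[OF d(1,2) N(2)] W(2) by simp
    show "V d \<notin> span {Y d}"
      using tangent_space_dependent[OF T(2,1) d' d(2) c p(1)] v Yc by auto
  qed
  then show ?thesis
    using h_change_chart[OF z c _ d', of V V] p d(2) T Yc by (simp add: cmap_lift)
qed

definition definite_at :: "real \<Rightarrow> ('m, real^'n) chart \<Rightarrow> real^'n \<Rightarrow> bool" where
  "definite_at s c x \<longleftrightarrow> (\<forall>y v. y \<noteq> 0 \<longrightarrow> v \<notin> span {y} \<longrightarrow> 0 < s * (v \<bullet> (h c (x, y) *v v)))"

lemma definite_at_cases:
  assumes c: "c \<in> atlas M" and x: "x \<in> cimg c"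
  shows "definite_at 1 c x \<or> definite_at (-1) c x"
proof -
  let ?Q = "\<lambda>y v. v \<bullet> (h c (x, y) *v v)"
  have "(\<forall>y v. y \<noteq> 0 \<longrightarrow> v \<notin> span {y} \<longrightarrow> ?Q y v > 0) \<or> (\<forall>y v. y \<noteq> 0 \<longrightarrow> v \<notin> span {y} \<longrightarrow> ?Q y v < 0)"
  proof (rule constant_sign_on_independent_pairs)
    show "DIM(real^'n) \<ge> 3" using dim3 by simp
    show "?Q y v \<noteq> 0" if "y \<noteq> 0" "v \<notin> span {y}" for y v
      using h_nonzero[OF c _ that(2)] that(1) x cimg_lift[OF c] by simp
    show "continuous_on (- {0}) (\<lambda>y. ?Q y v)" for v
      by (rule continuous_on_compose2[OF continuous_h[OF c]])
        (use x cimg_lift[OF c] in \<open>auto intro!: continuous_intros\<close>)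
    show "continuous_on UNIV (?Q y)" for y
      by (intro continuous_intros matrix_vector_mult_linear_continuous_on)
  qed
  then show ?thesis by (simp add: definite_at_def)
qed

lemma independent_pair:
  obtains y v :: "real^'n" where "y \<noteq> 0" "v \<notin> span {y}"
proof -
  have dim: "DIM(real^'n) \<ge> 3" using dim3 by simp
  obtain y :: "real^'n" where y: "y \<notin> span {0, 0}" using exists_not_in_span2[OF dim] .
  obtain v where v: "v \<notin> span {y, y}" using exists_not_in_span2[OF dim] .
  have "y \<noteq> 0" using y span_zero by blast
  moreover have "v \<notin> span {y}" using v by simp
  ultimately show ?thesis by (rule that)
qed

definition definite_points :: "real \<Rightarrow> 'm set" where
  "definite_points s = {p. \<exists>c\<in>atlas M. p \<in> cdom c \<and> definite_at s c (cmap c p)}"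

text \<open>Positivity on one fixed independent pair is an open condition on the base point, and it
  already decides the sign.\<close>

lemma openin_definite_points:
  assumes s: "s = 1 \<or> s = -1"
  shows "openin (mtop M) (definite_points s)"
proof (subst openin_subopen, intro ballI)
  fix p assume "p \<in> definite_points s"
  then obtain c where c: "c \<in> atlas M" "p \<in> cdom c" "definite_at s c (cmap c p)"
    unfolding definite_points_def by blast
  obtain y v :: "real^'n" where yv: "y \<noteq> 0" "v \<notin> span {y}" by (rule independent_pair)
  let ?f = "\<lambda>x. s * (v \<bullet> (h c (x, y) *v v))"
  let ?U = "{q \<in> cdom c. ?f (cmap c q) \<in> {0<..}}"
  have "continuous_on (cimg c) (\<lambda>x. v \<bullet> (h c (x, y) *v v))"
    by (rule continuous_on_compose2[OF continuous_h[OF c(1)]])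
      (use yv cimg_lift[OF c(1)] in \<open>auto intro!: continuous_intros\<close>)
  then have "continuous_on (cimg c) ?f" by (rule continuous_on_mult_left)
  then have "continuous_map (subtopology (mtop M) (cdom c)) euclideanreal (?f \<circ> cmap c)"
    by (intro continuous_map_compose[OF continuous_cmap[OF c(1)]]) simp
  then have "openin (subtopology (mtop M) (cdom c))
      {q \<in> topspace (subtopology (mtop M) (cdom c)). (?f \<circ> cmap c) q \<in> {0<..}}"
    by (rule openin_continuous_map_preimage) simp
  then have "openin (subtopology (mtop M) (cdom c)) ?U"
    by (simp only: topspace_chart_domain[OF c(1)] o_def)
  then have "openin (mtop M) ?U"
    using openin_cdom[OF c(1)] openin_trans_full by blast
  moreover have "p \<in> ?U" using c yv unfolding definite_at_def by simp
  moreover have "?U \<subseteq> definite_points s"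
  proof
    fix q assume q: "q \<in> ?U"
    then have "cmap c q \<in> cimg c" by (simp add: cimg_def)
    then have "definite_at 1 c (cmap c q) \<or> definite_at (-1) c (cmap c q)"
      by (rule definite_at_cases[OF c(1)])
    moreover have "\<not> definite_at (-s) c (cmap c q)"
    proof
      assume "definite_at (-s) c (cmap c q)"
      then have "0 < - s * (v \<bullet> (h c (cmap c q, y) *v v))"
        using yv unfolding definite_at_def by blast
      then show False using q by simp
    qed
    ultimately have "definite_at s c (cmap c q)" using s by auto
    then show "q \<in> definite_points s" using q c(1) unfolding definite_points_def by blast
  qed
  ultimately show "\<exists>T. openin (mtop M) T \<and> p \<in> T \<and> T \<subseteq> definite_points s" by blast
qed

text \<open>The value \<open>h(v, v)\<close> on one independent pair, computed in two charts, cannot have both signs.\<close>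

lemma definite_points_disjoint: "definite_points 1 \<inter> definite_points (-1) = {}"
proof (rule ccontr)
  assume "definite_points 1 \<inter> definite_points (-1) \<noteq> {}"
  then obtain p c d where c: "c \<in> atlas M" "p \<in> cdom c" "definite_at 1 c (cmap c p)"
    and d: "d \<in> atlas M" "p \<in> cdom d" "definite_at (-1) d (cmap d p)"
    unfolding definite_points_def by blast
  obtain y v :: "real^'n" where yv: "y \<noteq> 0" "v \<notin> span {y}" by (rule independent_pair)
  define Y where "Y = tvec_of M c p y"
  define V where "V = tvec_of M c p v"
  have T: "Y \<in> tangent_space M p" "V \<in> tangent_space M p"
    unfolding Y_def V_def by (rule tvec_of_in_tangent_space[OF c(1,2)])+
  have Yc: "Y c = y" "V c = v"
    unfolding Y_def V_def by (rule tvec_of_self[OF c(1,2)])+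
  have z: "(p, Y) \<in> slit_points M"
    unfolding Y_def by (rule tvec_of_slit_point[OF c(1,2) yv(1)])
  have "Y d \<noteq> 0" using slit_coord_nonzero[OF z d(1)] d(2) by simp
  moreover have "V d \<notin> span {Y d}"
    using tangent_space_dependent[OF T(2,1) d(1,2) c(1,2)] yv(2) Yc by auto
  ultimately have "V d \<bullet> (h d (cmap d p, Y d) *v V d) < 0"
    using d(3) unfolding definite_at_def by force
  moreover have "v \<bullet> (h c (cmap c p, y) *v v) > 0"
    using c(3) yv unfolding definite_at_def by force
  ultimately show False
    using h_change_chart[OF z c(1) _ d(1), of V V] c(2) d(2) T Yc by (simp add: cmap_lift)
qed

lemma positive_quasi_definite_of_definite:
  assumes s: "s = 1 \<or> s = -1" and all: "points M \<subseteq> definite_points s"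
  shows "positive_quasi_definite M (\<lambda>c u. s *\<^sub>R h c u)"
  unfolding positive_quasi_definite_iff
proof (intro ballI, clarify)
  fix c x y and v :: "real^'n" assume c: "c \<in> atlas M" and u: "(x, y) \<in> cimg (lift c)"
  have xy: "x \<in> cimg c" "y \<noteq> 0" using u cimg_lift[OF c] by auto
  have p: "cinv c x \<in> cdom c" "cmap c (cinv c x) = x" using cinv_in[OF xy(1)] cmap_cinv[OF xy(1)] by auto
  have "\<not> definite_at (-s) c x"
  proof
    assume "definite_at (-s) c x"
    then have "cinv c x \<in> definite_points (-s)"
      using c p unfolding definite_points_def by auto
    moreover have "cinv c x \<in> definite_points s" using all cdom_subset[OF c] p(1) by blast
    ultimately show False using definite_points_disjoint s by auto
  qed
  then have def: "definite_at s c x" using definite_at_cases[OF c xy(1)] s by auto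
  have eq: "v \<bullet> ((s *\<^sub>R h c (x, y)) *v v) = s * (v \<bullet> (h c (x, y) *v v))"
    by (simp flip: scaleR_matrix_vector_assoc)
  show "v \<bullet> ((s *\<^sub>R h c (x, y)) *v v) \<ge> 0 \<and>
      (v \<bullet> ((s *\<^sub>R h c (x, y)) *v v) = 0 \<longrightarrow> (\<exists>t. v = t *\<^sub>R y))"
  proof (cases "v \<in> span {y}")
    case True
    then obtain t where t: "v = t *\<^sub>R y" unfolding span_singleton by blast
    then have "v \<bullet> (h c (x, y) *v v) = 0" using h_radical(1)[OF c u, of v] by simp
    with t show ?thesis unfolding eq by auto
  next
    case False
    then have "0 < s * (v \<bullet> (h c (x, y) *v v))" using def xy(2) unfolding definite_at_def by blast
    then show ?thesis unfolding eq by linarith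
  qed
qed

lemma quasi_definite_of_connected:
  assumes "connected_space (mtop M)"
  shows "positive_quasi_definite M h \<or> positive_quasi_definite M (\<lambda>c u. - h c u)"
proof -
  have cover: "points M \<subseteq> definite_points 1 \<union> definite_points (-1)"
  proof
    fix p assume "p \<in> points M"
    then obtain c where c: "c \<in> atlas M" "p \<in> cdom c" using chart_at by blast
    then have "definite_at 1 c (cmap c p) \<or> definite_at (-1) c (cmap c p)"
      by (intro definite_at_cases) (auto simp: cimg_def)
    then show "p \<in> definite_points 1 \<union> definite_points (-1)"
      using c unfolding definite_points_def by blast
  qed
  have "definite_points 1 = {} \<or> definite_points (-1) = {}"
    using assms openin_definite_points[of 1] openin_definite_points[of "-1"] cover
      definite_points_disjoint unfolding connected_space_def by blast
  then have "points M \<subseteq> definite_points 1 \<or> points M \<subseteq> definite_points (-1)" using cover by blast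
  then show ?thesis
    using positive_quasi_definite_of_definite[of 1] positive_quasi_definite_of_definite[of "-1"] by auto
qed

end

theorem proposition3:
  fixes M :: "('m, real^'n::finite) mfd"
    and \<Gamma> :: "(('m, real^'n) tm, (real^'n) \<times> (real^'n)) vfield"
    and P :: "('p, 'q::euclidean_space) mfd"
    and \<pi> :: "('m, real^'n) tm \<Rightarrow> 'p"
    and \<omega> :: "(('m, real^'n) tm, (real^'n) \<times> (real^'n)) form2"
    and h :: "('m, 'n) components"
    and \<Omega> :: "('p, 'q) form2"
  assumes M: "smooth_manifold M" "paracompact_space (mtop M)"
    and n: "CARD('n) \<ge> 3"
    and \<Gamma>: "spray M \<Gamma>"
    and P: "path_space M \<Gamma> P \<pi>"
    and \<omega>: "admissible M \<Gamma> \<omega>" "has_components M \<Gamma> \<omega> h"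
      "\<forall>z\<in>slit_points M. characteristic (slit_bundle M) \<omega> z = spray_distribution M \<Gamma> z"
    and \<Omega>: "symplectic_form P \<Omega>"
      "\<forall>z\<in>slit_points M. \<forall>\<xi>\<in>tangent_space (slit_bundle M) z. \<forall>\<eta>\<in>tangent_space (slit_bundle M) z.
         pullback (slit_bundle M) P \<pi> \<Omega> z \<xi> \<eta> = \<omega> z \<xi> \<eta>"
    and planes: "\<forall>x\<in>points M. \<forall>W. tangent_subspace M x 2 W \<longrightarrow>
      (\<exists>N. totally_geodesic M \<Gamma> 2 N \<and> x \<in> N \<and> tangent_to M N x = W)"
  shows "(positive_quasi_definite M h \<longrightarrow>
           (\<forall>N. totally_geodesic M \<Gamma> 2 N \<longrightarrow> nonvanishing_on_bar M P \<pi> \<Omega> N)) \<and>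
         (connected_space (mtop M) \<and>
           (\<forall>N. totally_geodesic M \<Gamma> 2 N \<longrightarrow> nonvanishing_on_bar M P \<pi> \<Omega> N) \<longrightarrow>
           positive_quasi_definite M h \<or> positive_quasi_definite M (\<lambda>c u. - h c u))"
proof -
  interpret spray_form M \<Gamma> \<omega> h
    using M(1) \<Gamma> \<omega>(1,2) by unfold_locales
  have pull: "\<Omega> (\<pi> z) (push slit P \<pi> z \<xi>) (push slit P \<pi> z \<eta>) = \<omega> z \<xi> \<eta>"
    if "z \<in> hat M N" "\<xi> \<in> tangent_to slit (hat M N) z" "\<eta> \<in> tangent_to slit (hat M N) z" for N z \<xi> \<eta>
  proof -
    have "z \<in> slit_points M" using that(1) by (auto simp: hat_def)
    then show ?thesis
      using \<Omega>(2) that(2,3) slit.tangent_to_subset_tangent_space unfolding pullback_def by blast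
  qed
  have nonvanishing_iff: "nonvanishing_on_bar M P \<pi> \<Omega> N \<longleftrightarrow>
      (\<forall>z\<in>hat M N. \<exists>\<xi>\<in>tangent_to slit (hat M N) z. \<exists>\<eta>\<in>tangent_to slit (hat M N) z. \<omega> z \<xi> \<eta> \<noteq> 0)" for N
    unfolding nonvanishing_on_bar_def bar_tangent_def using pull by simp
  show ?thesis
  proof (intro conjI impI allI)
    fix N assume "positive_quasi_definite M h" "totally_geodesic M \<Gamma> 2 N"
    then show "nonvanishing_on_bar M P \<pi> \<Omega> N"
      unfolding nonvanishing_iff using form_nonzero_on_hat by blast
  next
    assume conv: "connected_space (mtop M) \<and>
      (\<forall>N. totally_geodesic M \<Gamma> 2 N \<longrightarrow> nonvanishing_on_bar M P \<pi> \<Omega> N)"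
    interpret spray_form_planes M \<Gamma> \<omega> h
      by unfold_locales (use conv planes n nonvanishing_iff in blast)+
    show "positive_quasi_definite M h \<or> positive_quasi_definite M (\<lambda>c u. - h c u)"
      using quasi_definite_of_connected conv by blast
  qed
qed

end
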